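(* Let $n, d_1, d_2$ be positive integers, and let $\mathbf{A} = [\mathbf{a}_1|\mathbf{a}_2|\dotsb|\mathbf{a}_n] \in \mathbb{R}^{d_1\times n}$ and $\mathbf{B} = [\mathbf{b}_1|\mathbf{b}_2|\dotsb|\mathbf{b}_n] \in \mathbb{R}^{d_2\times n}$ be nonzero real matrices with columns $\mathbf{a}_i$ and $\mathbf{b}_i$. Define \[ p_i := \frac12\left( \frac{\|\mathbf{a}_i\|^2}{\|\mathbf{A}\|_F^2} + \frac{\|\mathbf{b}_i\|^2}{\|\mathbf{B}\|_F^2}\right), \quad i \in \{1,\dots,n\}, \] which is a probability distribution on $\{1,\dots,n\}$. Let $m$ be a positive integer and let $\mathbf{X}_1,\dots,\mathbf{X}_m$ be i.i.d. random $d_1\times d_2$ matrices with $\Pr\{\mathbf{X}_1 = \frac{1}{p_i}\mathbf{a}_i\mathbf{b}_i^\top\} = p_i$ for each $i$ with $p_i>0$ (more precisely, an index $I$ is drawn with $\Pr\{I=i\}=p_i$ and $\mathbf{X}_1 = \frac{1}{p_I}\mathbf{a}_I\mathbf{b}_I^\top$). Define the estimator $\widehat{\mathbf{A}\mathbf{B}^\top} := \frac1m\sum_{j=1}^m \mathbf{X}_j$. Then for any $t>0$, \[ \Pr\left\{ \frac{\|\widehat{\mathbf{A}\mathbf{B}^\top} - \mathbf{A}\mathbf{B}^\top\|}{\|\mathbf{A}\|\,\|\mathbf{B}\|} > \sqrt{\frac{4\,(\mathrm{sr}(\mathbf{A})\vee \mathrm{sr}(\mathbf{B}))\,t}{m}}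 + \frac{\left(\sqrt{\mathrm{sr}(\mathbf{A})\,\mathrm{sr}(\mathbf{B})}+1\right)t}{m} \right\} \le 4\,(\mathrm{sr}(\mathbf{A})\wedge \mathrm{sr}(\mathbf{B}))\cdot \frac{t}{e^t - t - 1}. \]
   Context: For a vector, $\|\cdot\|$ is the Euclidean norm; for a matrix, $\|\cdot\|$ is the spectral (operator) norm and $\|\cdot\|_F$ is the Frobenius norm. The stable rank of a nonzero matrix $\mathbf{M}$ is $\mathrm{sr}(\mathbf{M}) := \|\mathbf{M}\|_F^2/\|\mathbf{M}\|^2$. The notation $a\vee b = \max\{a,b\}$ and $a\wedge b = \min\{a,b\}$. $\mathbf{M}^\top$ denotes the transpose. *)

theory Defs
  imports "HOL-Probability.Probability"
begin

abbreviation spectral_norm :: "real^'n^'m \<Rightarrow> real" where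
  "spectral_norm M \<equiv> onorm ((*v) M)"

text \<open>The norm that the library puts on \<open>real^'n^'m\<close> is the Frobenius norm, not the
  operator norm; see \<open>frobenius_norm_eq\<close>.\<close>
abbreviation frobenius_norm :: "real^'n^'m \<Rightarrow> real" where
  "frobenius_norm M \<equiv> norm M"

definition stable_rank :: "real^'n^'m \<Rightarrow> real" where
  "stable_rank M = (frobenius_norm M)\<^sup>2 / (spectral_norm M)\<^sup>2"

definition outer_product :: "real^'m \<Rightarrow> real^'n \<Rightarrow> real^'n^'m" where
  "outer_product a b = (\<chi> i j. a $ i * b $ j)"

definition sampling_prob :: "real^'n^'d1 \<Rightarrow> real^'n^'d2 \<Rightarrow> 'n \<Rightarrow> real" where
  "sampling_prob A B i =
     1 / 2 * ((norm (column i A))\<^sup>2 / (frobenius_norm A)\<^sup>2 +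
              (norm (column i B))\<^sup>2 / (frobenius_norm B)\<^sup>2)"

text \<open>Only meaningful for nonzero \<open>A\<close> and \<open>B\<close>; see \<open>pmf_sampling_pmf\<close>.\<close>
definition sampling_pmf :: "real^'n^'d1 \<Rightarrow> real^'n^'d2 \<Rightarrow> 'n pmf" where
  "sampling_pmf A B = embed_pmf (sampling_prob A B)"

text \<open>For indices of probability zero the value is irrelevant (here it is the zero matrix).\<close>
definition sample_matrix :: "real^'n^'d1 \<Rightarrow> real^'n^'d2 \<Rightarrow> 'n \<Rightarrow> real^'d2^'d1" where
  "sample_matrix A B i =
     (1 / sampling_prob A B i) *\<^sub>R outer_product (column i A) (column i B)"

definition sample_law :: "real^'n^'d1 \<Rightarrow> real^'n^'d2 \<Rightarrow> (real^'d2^'d1) measure" where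
  "sample_law A B = distr (measure_pmf (sampling_pmf A B)) borel (sample_matrix A B)"

definition product_estimator :: "nat \<Rightarrow> (nat \<Rightarrow> 'w \<Rightarrow> real^'d2^'d1) \<Rightarrow> 'w \<Rightarrow> real^'d2^'d1" where
  "product_estimator m X \<omega> = (1 / real m) *\<^sub>R (\<Sum>j=1..m. X j \<omega>)"

lemma frobenius_norm_eq:
  fixes M :: "real^'n^'m"
  shows "frobenius_norm M = sqrt (\<Sum>i\<in>UNIV. \<Sum>j\<in>UNIV. (M $ i $ j)\<^sup>2)"
  by (simp add: norm_vec_def L2_set_def sum_nonneg)

lemma outer_product_eq_matrix_mult:
  "outer_product a b = (columnvector a :: real^1^'m) ** transpose (columnvector b :: real^1^'n)"
  by (simp add: outer_product_def columnvector_def transpose_def matrix_matrix_mult_def)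

lemma sum_norm_column:
  fixes M :: "real^'n^'m"
  shows "(\<Sum>i\<in>UNIV. (norm (column i M))\<^sup>2) = (frobenius_norm M)\<^sup>2"
proof -
  have "(\<Sum>i\<in>UNIV. (norm (column i M))\<^sup>2) = (\<Sum>i\<in>UNIV. \<Sum>k\<in>UNIV. (M $ k $ i)\<^sup>2)"
    by (simp add: norm_vec_def L2_set_def column_def sum_nonneg)
  also have "\<dots> = (\<Sum>k\<in>UNIV. \<Sum>i\<in>UNIV. (M $ k $ i)\<^sup>2)"
    by (rule sum.swap)
  also have "\<dots> = (frobenius_norm M)\<^sup>2"
    unfolding frobenius_norm_eq by (simp add: sum_nonneg)
  finally show ?thesis .
qed

lemma sampling_prob_nonneg: "0 \<le> sampling_prob A B i"
  by (simp add: sampling_prob_def)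

lemma sum_sampling_prob:
  assumes "A \<noteq> 0" "B \<noteq> 0"
  shows "(\<Sum>i\<in>UNIV. sampling_prob A B i) = 1"
proof -
  have "(\<Sum>i\<in>UNIV. sampling_prob A B i) =
      1 / 2 * ((\<Sum>i\<in>UNIV. (norm (column i A))\<^sup>2) / (frobenius_norm A)\<^sup>2 +
               (\<Sum>i\<in>UNIV. (norm (column i B))\<^sup>2) / (frobenius_norm B)\<^sup>2)"
    by (simp only: sampling_prob_def sum_distrib_left [symmetric] sum.distrib sum_divide_distrib)
  with assms show ?thesis
    by (simp add: sum_norm_column)
qed

lemma pmf_sampling_pmf:
  assumes "A \<noteq> 0" "B \<noteq> 0"
  shows "pmf (sampling_pmf A B) i = sampling_prob A B i"
  unfolding sampling_pmf_def
proof (rule pmf_embed_pmf)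
  show "0 \<le> sampling_prob A B x" for x
    by (rule sampling_prob_nonneg)
  show "(\<integral>\<^sup>+x. ennreal (sampling_prob A B x) \<partial>count_space UNIV) = 1"
    by (simp add: nn_integral_count_space_finite sum_ennreal sampling_prob_nonneg
        sum_sampling_prob assms)
qed

end

theory Submission
  imports Defs
begin

text \<open>
  The self-adjoint dilation turns the spectral norm of the sum of the centred samples into the largest
  value, on unit vectors, of the quadratic form of a sum \<open>S\<close> of independent self-adjoint operators.
  The Laplace transform method is applied to \<open>tr (exp S - 1 - S)\<close> rather than to \<open>tr (exp S)\<close>, which
  replaces the dimension by \<open>tr V / v\<close>, where \<open>V\<close> is the variance of one step and \<open>V \<le> v\<close>. Adding one
  step \<open>Y\<close> and using Golden--Thompson and \<open>exp Y \<le> 1 + Y + g Y\<^sup>2\<close> gives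
  \<open>E tr (exp (S + Y)) \<le> tr (exp S) + g tr (V exp S)\<close>. In
  \<open>tr (V exp S) = tr (V (exp S - 1 - S)) + tr V + tr (V S)\<close> the first term is at most
  \<open>v tr (exp S - 1 - S)\<close> and the last one is a martingale, whence
  \<open>E tr (exp S - 1 - S) \<le> tr V / v ((1 + g v)\<^sup>m - 1)\<close> after \<open>m\<close> steps. No spectral theorem is needed:
  operator inequalities for \<open>exp\<close> come from the convexity of \<open>u \<mapsto> l (exp (u S))\<close> for suitable
  linear functionals \<open>l\<close>, and Golden--Thompson from the Lie product formula and trace inequalities for
  powers with exponent \<open>2\<^sup>k\<close>, which only need \<open>tr (S S\<^sup>*) \<ge> 0\<close>.
\<close>

section \<open>The Banach algebra of operators on a Euclidean space\<close>

text \<open>A separate type is needed because the library multiplies elements of \<open>real^'n^'n\<close> entrywise.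
  With composition as product and the operator norm, the generic \<open>exp\<close> is the operator exponential.\<close>

typedef (overloaded) 'a endo = "UNIV :: ('a::euclidean_space \<Rightarrow>\<^sub>L 'a) set"
  morphisms blinfun_of_endo endo_of_blinfun ..

setup_lifting type_definition_endo

lift_definition app :: "'a::euclidean_space endo \<Rightarrow> 'a \<Rightarrow> 'a" is blinfun_apply .

lift_definition endo_of :: "('a::euclidean_space \<Rightarrow> 'a) \<Rightarrow> 'a endo" is Blinfun .

lemma app_endo_of: "linear f \<Longrightarrow> app (endo_of f) = f"
  by transfer (simp add: bounded_linear_Blinfun_apply linear_conv_bounded_linear)

lemma endo_eqI: "(\<And>x. app S x = app T x) \<Longrightarrow> S = T"
  by transfer (rule blinfun_eqI)

instantiation endo :: (euclidean_space) real_vector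
begin

lift_definition zero_endo :: "'a endo" is 0 .
lift_definition plus_endo :: "'a endo \<Rightarrow> 'a endo \<Rightarrow> 'a endo" is "(+)" .
lift_definition minus_endo :: "'a endo \<Rightarrow> 'a endo \<Rightarrow> 'a endo" is "(-)" .
lift_definition uminus_endo :: "'a endo \<Rightarrow> 'a endo" is "uminus" .
lift_definition scaleR_endo :: "real \<Rightarrow> 'a endo \<Rightarrow> 'a endo" is scaleR .

instance
  by standard (transfer, simp add: scaleR_add_right scaleR_add_left)+

end

instantiation endo :: (euclidean_space) real_normed_algebra_1
begin

lift_definition one_endo :: "'a endo" is id_blinfun .
lift_definition times_endo :: "'a endo \<Rightarrow> 'a endo \<Rightarrow> 'a endo" is blinfun_compose .
lift_definition norm_endo :: "'a endo \<Rightarrow> real" is norm .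
definition dist_endo :: "'a endo \<Rightarrow> 'a endo \<Rightarrow> real" where
  "dist_endo S T = norm (S - T)"
definition sgn_endo :: "'a endo \<Rightarrow> 'a endo" where
  "sgn_endo S = S /\<^sub>R norm S"
definition uniformity_endo :: "('a endo \<times> 'a endo) filter" where
  "uniformity_endo = (INF e\<in>{0<..}. principal {(S, T). dist S T < e})"
definition open_endo :: "'a endo set \<Rightarrow> bool" where
  "open_endo U = (\<forall>S\<in>U. eventually (\<lambda>(S', T). S' = S \<longrightarrow> T \<in> U) uniformity)"

instance
proof
  fix R S T :: "'a endo" and a :: real
  show "R * S * T = R * (S * T)" by transfer (rule blinfun_eqI, simp)
  show "(R + S) * T = R * T + S * T" by transfer (rule blinfun_eqI, simp add: blinfun.add_left)
  show "R * (S + T) = R * S + R * T"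
    by transfer (rule blinfun_eqI, simp add: blinfun.add_left blinfun.add_right)
  show "1 * S = S" by transfer (rule blinfun_eqI, simp)
  show "S * 1 = S" by transfer (rule blinfun_eqI, simp)
  show "(0::'a endo) \<noteq> 1"
  proof
    assume "(0::'a endo) = 1"
    then have "norm (0 :: 'a \<Rightarrow>\<^sub>L 'a) = norm (id_blinfun :: 'a \<Rightarrow>\<^sub>L 'a)"
      by transfer simp
    then show False by simp
  qed
  show "a *\<^sub>R S * T = a *\<^sub>R (S * T)"
    by transfer (rule blinfun_eqI, simp add: blinfun.scaleR_left)
  show "S * a *\<^sub>R T = a *\<^sub>R (S * T)"
    by transfer (rule blinfun_eqI, simp add: blinfun.scaleR_left blinfun.scaleR_right)
  show "(norm S = 0) = (S = 0)" by transfer simp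
  show "norm (S + T) \<le> norm S + norm T" by transfer (rule norm_triangle_ineq)
  show "norm (a *\<^sub>R S) = \<bar>a\<bar> * norm S" by transfer simp
  show "norm (S * T) \<le> norm S * norm T" by transfer (rule norm_blinfun_compose)
  show "norm (1::'a endo) = 1" by transfer simp
qed (rule dist_endo_def sgn_endo_def uniformity_endo_def open_endo_def)+

end

instance endo :: (euclidean_space) banach
proof
  fix X :: "nat \<Rightarrow> 'a endo"
  assume X: "Cauchy X"
  have n: "norm (blinfun_of_endo S - blinfun_of_endo T) = norm (S - T)" for S T :: "'a endo"
    by transfer simp
  have "Cauchy (\<lambda>n. blinfun_of_endo (X n))"
    using X unfolding Cauchy_iff n .
  then obtain L where "(\<lambda>n. blinfun_of_endo (X n)) \<longlonglongrightarrow> L"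
    using Cauchy_convergent_iff convergent_def by blast
  then have "X \<longlonglongrightarrow> endo_of_blinfun L"
    unfolding LIMSEQ_iff n[symmetric] by (simp add: endo_of_blinfun_inverse)
  then show "convergent X"
    by (rule convergentI)
qed

lemma app_add [simp]: "app (S + T) x = app S x + app T x"
  by transfer (rule blinfun.add_left)
lemma app_diff [simp]: "app (S - T) x = app S x - app T x"
  by transfer (rule blinfun.diff_left)
lemma app_zero [simp]: "app 0 x = 0"
  by transfer simp
lemma app_one [simp]: "app 1 x = x"
  by transfer simp
lemma app_mult [simp]: "app (S * T) x = app S (app T x)"
  by transfer simp
lemma app_scaleR [simp]: "app (a *\<^sub>R S) x = a *\<^sub>R app S x"
  by transfer (rule blinfun.scaleR_left)
lemma app_sum [simp]: "app (\<Sum>i\<in>I. f i) x = (\<Sum>i\<in>I. app (f i) x)"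
  by (induction I rule: infinite_finite_induct) auto

lemma norm_app: "norm (app S x) \<le> norm S * norm x"
  by transfer (rule norm_blinfun)

lemma norm_endo_bound: "0 \<le> b \<Longrightarrow> (\<And>x. norm (app S x) \<le> b * norm x) \<Longrightarrow> norm S \<le> b"
  by transfer (rule norm_blinfun_bound)

lemma linear_app: "linear (app S)"
  by transfer (rule bounded_linear.linear, rule blinfun.bounded_linear_right)

text \<open>These functionals probe an operator through its bilinear form; being bounded and linear,
  they pass through the exponential series and through derivatives.\<close>

lemma bounded_linear_app_inner: "bounded_linear (\<lambda>S. app S x \<bullet> y)"
proof (rule bounded_linear_intro[where K = "norm x * norm y"])
  fix S :: "'a endo"
  have "\<bar>app S x \<bullet> y\<bar> \<le> norm (app S x) * norm y"
    by (rule Cauchy_Schwarz_ineq2)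
  also have "\<dots> \<le> norm S * norm x * norm y"
    by (intro mult_right_mono norm_app) simp
  finally show "norm (app S x \<bullet> y) \<le> norm S * (norm x * norm y)"
    by (simp add: mult.assoc)
qed (simp_all add: inner_add_left)

section \<open>Adjoints and self-adjoint operators\<close>

definition adj :: "'a::euclidean_space endo \<Rightarrow> 'a endo" where
  "adj S = endo_of (adjoint (app S))"

lemma inner_app_adj: "x \<bullet> app (adj S) y = app S x \<bullet> y"
  unfolding adj_def
  by (simp add: app_endo_of linear_app adjoint_linear adjoint_works)

lemma inner_app_adj2: "app (adj S) y \<bullet> x = y \<bullet> app S x"
  by (metis inner_app_adj inner_commute)

definition selfadj :: "'a::euclidean_space endo \<Rightarrow> bool" where
  "selfadj S \<longleftrightarrow> (\<forall>x y. app S x \<bullet> y = x \<bullet> app S y)"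

lemma selfadjD: "selfadj S \<Longrightarrow> app S x \<bullet> y = x \<bullet> app S y"
  by (simp add: selfadj_def)

lemma selfadj_0 [simp]: "selfadj 0" by (simp add: selfadj_def)
lemma selfadj_1 [simp]: "selfadj 1" by (simp add: selfadj_def)
lemma selfadj_add: "selfadj S \<Longrightarrow> selfadj T \<Longrightarrow> selfadj (S + T)"
  by (simp add: selfadj_def inner_add_left inner_add_right)
lemma selfadj_diff: "selfadj S \<Longrightarrow> selfadj T \<Longrightarrow> selfadj (S - T)"
  by (simp add: selfadj_def inner_diff_left inner_diff_right)
lemma selfadj_scaleR: "selfadj S \<Longrightarrow> selfadj (a *\<^sub>R S)"
  by (simp add: selfadj_def)
lemma selfadj_power: "selfadj S \<Longrightarrow> selfadj (S ^ n)"
proof (induction n)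
  case (Suc n)
  have "app (S ^ Suc n) x \<bullet> y = x \<bullet> app (S ^ Suc n) y" for x y
  proof -
    have "app (S ^ Suc n) x \<bullet> y = x \<bullet> app (S ^ n * S) y"
      using Suc by (simp add: selfadjD)
    then show ?thesis by (simp only: power_Suc2)
  qed
  then show ?case by (simp add: selfadj_def)
qed simp

lemma selfadj_mult_adj: "selfadj (S * adj S)"
proof -
  have "app (S * adj S) x \<bullet> y = x \<bullet> app (S * adj S) y" for x y
  proof -
    have "app (S * adj S) x \<bullet> y = app (adj S) x \<bullet> app (adj S) y"
      by (simp add: inner_app_adj)
    also have "\<dots> = x \<bullet> app (S * adj S) y"
      by (simp add: inner_app_adj2)
    finally show ?thesis .
  qed
  then show ?thesis by (simp add: selfadj_def)
qed

text \<open>Self-adjointness is the vanishing of the bounded functionals \<open>l\<close> below.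
  Powers of \<open>S\<close> are self-adjoint, so \<open>l\<close> kills every term of the
  exponential series and hence its sum.\<close>

lemma selfadj_exp:
  assumes "selfadj S"
  shows "selfadj (exp S)"
  unfolding selfadj_def
proof (intro allI)
  fix x y
  define l where "l T = app T x \<bullet> y - app T y \<bullet> x" for T :: "'a endo"
  have l: "bounded_linear l"
    unfolding l_def by (intro bounded_linear_sub bounded_linear_app_inner)
  have z: "l (S ^ n /\<^sub>R fact n) = 0" for n
    using selfadjD[OF selfadj_power[OF assms], of n x y]
    by (simp add: l_def inner_commute[of x])
  have "(\<lambda>n. l (S ^ n /\<^sub>R fact n)) sums l (exp S)"
    by (intro bounded_linear.sums[OF l] exp_converges)
  then have "l (exp S) = 0"
    unfolding z by (simp add: sums_iff)
  then show "app (exp S) x \<bullet> y = x \<bullet> app (exp S) y"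
    by (simp add: l_def inner_commute)
qed

section \<open>Trace and positive semidefinite operators\<close>

definition tr :: "'a::euclidean_space endo \<Rightarrow> real" where
  "tr S = (\<Sum>b\<in>Basis. app S b \<bullet> b)"

lemma bounded_linear_tr: "bounded_linear tr"
  unfolding tr_def by (intro bounded_linear_sum bounded_linear_app_inner)

lemma bounded_linear_tr_mult: "bounded_linear (\<lambda>S. tr (Q * S))"
  by (rule bounded_linear_compose[OF bounded_linear_tr bounded_linear_mult_right])

lemma tr_add: "tr (S + T) = tr S + tr T"
  and tr_diff: "tr (S - T) = tr S - tr T"
  and tr_scaleR: "tr (a *\<^sub>R S) = a * tr S"
  and tr_0 [simp]: "tr 0 = 0"
  and tr_sum: "tr (\<Sum>i\<in>I. f i) = (\<Sum>i\<in>I. tr (f i))"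
  by (simp_all add: tr_def inner_add_left inner_diff_left sum.distrib sum_subtractf
      sum_distrib_left inner_sum_left sum.swap[of _ Basis])

lemma tr_mult: "tr (S * T) = (\<Sum>b\<in>Basis. \<Sum>c\<in>Basis. (app T b \<bullet> c) * (app S c \<bullet> b))"
proof -
  have "app S (app T b) \<bullet> b = (\<Sum>c\<in>Basis. (app T b \<bullet> c) * (app S c \<bullet> b))" for b
  proof -
    have "app S (app T b) = app S (\<Sum>c\<in>Basis. (app T b \<bullet> c) *\<^sub>R c)"
      by (simp add: euclidean_representation)
    also have "\<dots> = (\<Sum>c\<in>Basis. (app T b \<bullet> c) *\<^sub>R app S c)"
      by (simp add: linear_sum[OF linear_app] linear_scale[OF linear_app])
    finally show ?thesis by (simp add: inner_sum_left)
  qed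
  then show ?thesis by (simp add: tr_def)
qed

lemma tr_commute: "tr (S * T) = tr (T * S)"
  unfolding tr_mult by (subst sum.swap) (simp add: mult.commute)

lemma tr_adj: "tr (adj S) = tr S"
  unfolding tr_def inner_app_adj2 by (simp add: inner_commute)

lemma adj_mult: "adj (S * T) = adj T * adj S"
proof (rule endo_eqI)
  fix x
  show "app (adj (S * T)) x = app (adj T * adj S) x"
    by (rule vector_eq_ldot[THEN iffD1]) (simp add: inner_app_adj)
qed

lemma adj_adj: "adj (adj S) = S"
proof (rule endo_eqI)
  fix x
  show "app (adj (adj S)) x = app S x"
    by (rule vector_eq_ldot[THEN iffD1]) (simp add: inner_app_adj inner_app_adj2)
qed

lemma adj_diff: "adj (S - T) = adj S - adj T"
proof (rule endo_eqI)
  fix x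
  show "app (adj (S - T)) x = app (adj S - adj T) x"
    by (rule vector_eq_ldot[THEN iffD1]) (simp add: inner_app_adj inner_diff_left inner_diff_right)
qed

lemma adj_eq_selfadj: "selfadj S \<Longrightarrow> adj S = S"
proof (rule endo_eqI)
  fix x assume "selfadj S"
  then show "app (adj S) x = app S x"
    by (intro vector_eq_ldot[THEN iffD1]) (simp add: inner_app_adj selfadjD)
qed

definition psd :: "'a::euclidean_space endo \<Rightarrow> bool" where
  "psd S \<longleftrightarrow> (\<forall>x. 0 \<le> app S x \<bullet> x)"

lemma tr_nonneg: "psd S \<Longrightarrow> 0 \<le> tr S"
  by (simp add: psd_def tr_def sum_nonneg)

lemma psd_congruence: "psd Q \<Longrightarrow> selfadj R \<Longrightarrow> psd (R * Q * R)"
  by (simp add: psd_def selfadjD)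

text \<open>This trace is the squared Hilbert-Schmidt norm of \<open>S\<close>. Its sign is the
  source of the trace inequalities behind Golden--Thompson.\<close>

lemma tr_mult_adj_nonneg: "0 \<le> tr (S * adj S)"
proof (rule tr_nonneg, unfold psd_def, intro allI)
  fix x
  have "app (S * adj S) x \<bullet> x = app (adj S) x \<bullet> app (adj S) x"
    by (simp add: inner_app_adj)
  then show "0 \<le> app (S * adj S) x \<bullet> x" by simp
qed

section \<open>The Golden--Thompson inequality\<close>

lemma power_mult_swap: "(S * T) ^ n * S = S * (T * S) ^ n" for S T :: "'a::monoid_mult"
proof (induction n)
  case (Suc n)
  have "(S * T) ^ Suc n * S = S * T * ((S * T) ^ n * S)"
    by (simp add: mult.assoc)
  then show ?case by (simp add: Suc mult.assoc)
qed simp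

text \<open>Splitting off the outer factors, \<open>(S * T) ^ Suc k = S * (T * S) ^ k * T\<close>;
  cyclicity of the trace then moves \<open>S\<close> to the end.\<close>

lemma tr_power_commute: "tr ((S * T) ^ n) = tr ((T * S) ^ n)"
proof (cases n)
  case (Suc k)
  have "tr ((S * T) ^ n) = tr ((S * T) ^ k * S * T)"
    by (simp only: Suc power_Suc2 mult.assoc)
  also have "\<dots> = tr (S * ((T * S) ^ k * T))"
    by (simp only: power_mult_swap mult.assoc)
  also have "\<dots> = tr ((T * S) ^ k * T * S)"
    by (rule tr_commute)
  also have "\<dots> = tr ((T * S) ^ n)"
    by (simp only: Suc power_Suc2 mult.assoc)
  finally show ?thesis .
qed simp

text \<open>Expand the squared Hilbert-Schmidt norm of \<open>S - adj S\<close>; the two square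
  terms agree because an operator and its adjoint have the same trace.\<close>

lemma tr_square_le: "tr (S * S) \<le> tr (S * adj S)"
proof -
  have "0 \<le> tr ((S - adj S) * adj (S - adj S))"
    by (rule tr_mult_adj_nonneg)
  also have "\<dots> = 2 * tr (S * adj S) - 2 * tr (S * S)"
    using tr_adj[of "S * S"] tr_commute[of S "adj S"]
    by (simp add: adj_diff adj_adj adj_mult algebra_simps tr_add tr_diff)
  finally show ?thesis by simp
qed

text \<open>The inequality of arithmetic and geometric means for the Hilbert-Schmidt inner product,
  from the squared norm of \<open>P - Q\<close>.\<close>

lemma tr_mult_le_half:
  assumes "selfadj P" "selfadj Q"
  shows "tr (P * Q) \<le> (tr (P * P) + tr (Q * Q)) / 2"
proof -
  have "0 \<le> tr ((P - Q) * adj (P - Q))"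
    by (rule tr_mult_adj_nonneg)
  also have "\<dots> = tr (P * P) + tr (Q * Q) - 2 * tr (P * Q)"
    using tr_commute[of P Q] assms
    by (simp add: adj_eq_selfadj selfadj_diff algebra_simps tr_add tr_diff)
  finally show ?thesis by simp
qed

text \<open>The two families feed each other, so they share one induction. For the first at
  \<open>Suc k\<close>, the second at \<open>k\<close> symmetrises \<open>P * Q\<close>, rotation
  turns the result into \<open>P ^ 2 * Q ^ 2\<close>, and the first at \<open>k\<close> applies to
  these squares. For the second at \<open>Suc k\<close>, apply the second at \<open>k\<close> to
  \<open>S * S\<close>, rotate to \<open>S * adj S * (adj S * S)\<close>, and separate these two
  self-adjoint factors by the first at \<open>k\<close>.\<close>

lemma tr_power_ineqs:
  "(\<forall>P Q :: 'a::euclidean_space endo. selfadj P \<longrightarrow> selfadj Q \<longrightarrow> tr ((P * Q) ^ 2 ^ k) \<le> tr (P ^ 2 ^ k * Q ^ 2 ^ k)) \<and>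
   (\<forall>S :: 'a endo. tr (S ^ 2 ^ Suc k) \<le> tr ((S * adj S) ^ 2 ^ k))"
proof (induction k)
  case 0
  show ?case by (simp add: tr_square_le power2_eq_square)
next
  case (Suc k)
  then have G: "tr ((P * Q) ^ 2 ^ k) \<le> tr (P ^ 2 ^ k * Q ^ 2 ^ k)" if "selfadj P" "selfadj Q" for P Q :: "'a endo"
    using that by blast
  from Suc have W: "tr (S ^ 2 ^ Suc k) \<le> tr ((S * adj S) ^ 2 ^ k)" for S :: "'a endo"
    by blast
  have "tr ((P * Q) ^ 2 ^ Suc k) \<le> tr (P ^ 2 ^ Suc k * Q ^ 2 ^ Suc k)"
    if PQ: "selfadj P" "selfadj Q" for P Q :: "'a endo"
  proof -
    have "tr ((P * Q) ^ 2 ^ Suc k) \<le> tr ((P * Q * adj (P * Q)) ^ 2 ^ k)"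
      by (rule W)
    also have "\<dots> = tr ((P * (Q * Q * P)) ^ 2 ^ k)"
      using PQ by (simp add: adj_mult adj_eq_selfadj mult.assoc)
    also have "\<dots> = tr ((Q * Q * (P * P)) ^ 2 ^ k)"
      by (subst tr_power_commute) (simp add: mult.assoc)
    also have "\<dots> = tr ((P ^ 2 * Q ^ 2) ^ 2 ^ k)"
      by (subst tr_power_commute) (simp add: power2_eq_square)
    also have "\<dots> \<le> tr ((P ^ 2) ^ 2 ^ k * (Q ^ 2) ^ 2 ^ k)"
      using PQ by (intro G selfadj_power)
    finally show ?thesis by (simp add: power_mult)
  qed
  moreover have "tr (S ^ 2 ^ Suc (Suc k)) \<le> tr ((S * adj S) ^ 2 ^ Suc k)" for S :: "'a endo"
  proof -
    have sa: "selfadj (adj S * S)" "selfadj (S * adj S)"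
      using selfadj_mult_adj[of S] selfadj_mult_adj[of "adj S"] by (simp_all add: adj_adj)
    have "tr (S ^ 2 ^ Suc (Suc k)) = tr ((S * S) ^ 2 ^ Suc k)"
      by (simp add: power_mult flip: power2_eq_square)
    also have "\<dots> \<le> tr ((S * S * adj (S * S)) ^ 2 ^ k)"
      by (rule W)
    also have "\<dots> = tr ((S * (S * adj S * adj S)) ^ 2 ^ k)"
      by (simp add: adj_mult mult.assoc)
    also have "\<dots> = tr ((S * adj S * (adj S * S)) ^ 2 ^ k)"
      by (subst tr_power_commute) (simp add: mult.assoc)
    also have "\<dots> \<le> tr ((S * adj S) ^ 2 ^ k * (adj S * S) ^ 2 ^ k)"
      using sa by (intro G)
    also have "\<dots> \<le> (tr ((S * adj S) ^ 2 ^ k * (S * adj S) ^ 2 ^ k)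
        + tr ((adj S * S) ^ 2 ^ k * (adj S * S) ^ 2 ^ k)) / 2"
      using sa by (intro tr_mult_le_half selfadj_power)
    also have "\<dots> = (tr ((S * adj S) ^ 2 ^ Suc k) + tr ((adj S * S) ^ 2 ^ Suc k)) / 2"
      by (simp only: power_add[symmetric] mult_2[symmetric] power_Suc[symmetric])
    \<comment> \<open>Equal powers of \<open>S * adj S\<close> and \<open>adj S * S\<close> have the
      same trace, so the mean collapses to one of its terms.\<close>
    also have "\<dots> = tr ((S * adj S) ^ 2 ^ Suc k)"
      by (subst (2) tr_power_commute) simp
    finally show ?thesis .
  qed
  ultimately show ?case by blast
qed

text \<open>Telescoping. The factor \<open>K ^ n\<close> stays bounded in the application, where
  \<open>K\<close> is \<open>exp (h * c)\<close> with \<open>n * h = 1\<close>.\<close>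

lemma norm_power_diff_le:
  fixes a b :: "'a::real_normed_algebra_1"
  assumes "norm a \<le> K" "norm b \<le> K" "1 \<le> K"
  shows "norm (a ^ n - b ^ n) \<le> real n * K ^ n * norm (a - b)"
proof (induction n)
  case (Suc n)
  have "a ^ Suc n - b ^ Suc n = a * (a ^ n - b ^ n) + (a - b) * b ^ n"
    by (simp add: algebra_simps)
  then have "norm (a ^ Suc n - b ^ Suc n) \<le> norm (a * (a ^ n - b ^ n)) + norm ((a - b) * b ^ n)"
    by (simp only: norm_triangle_ineq)
  also have "norm (a * (a ^ n - b ^ n)) \<le> norm a * norm (a ^ n - b ^ n)"
    by (rule norm_mult_ineq)
  also have "\<dots> \<le> K * (real n * K ^ n * norm (a - b))"
    using assms by (intro mult_mono Suc) auto
  also have "norm ((a - b) * b ^ n) \<le> norm (a - b) * norm (b ^ n)"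
    by (rule norm_mult_ineq)
  also have "\<dots> \<le> norm (a - b) * K ^ Suc n"
  proof (rule mult_left_mono)
    have "norm (b ^ n) \<le> norm b ^ n" by (rule norm_power_ineq)
    also have "\<dots> \<le> K ^ n" using assms by (intro power_mono) auto
    also have "\<dots> \<le> K ^ Suc n" using assms by (intro power_increasing) auto
    finally show "norm (b ^ n) \<le> K ^ Suc n" .
  qed simp
  finally show ?case by (simp add: algebra_simps)
qed simp

lemma exp_scaleR_of_nat: "exp (real n *\<^sub>R x) = exp x ^ n" for x :: "'a::{real_normed_algebra_1,banach}"
proof (induction n)
  case (Suc n)
  have "exp (x + real n *\<^sub>R x) = exp x * exp (real n *\<^sub>R x)"
    by (rule exp_add_commuting) simp
  then show ?case by (simp add: Suc algebra_simps)
qed simp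

text \<open>The one-step error \<open>F h\<close> vanishes at 0 together with its derivative, so it
  is o(h). Since \<open>exp (a + b)\<close> is also a power with exponent \<open>Suc n\<close>,
  comparing the two powers multiplies the error by at most \<open>Suc n * exp c\<close>, and with
  \<open>h = 1 / Suc n\<close> the product still tends to 0.\<close>

lemma Lie_product_formula:
  fixes a b :: "'a::{real_normed_algebra_1,banach}"
  shows "(\<lambda>n. (exp (a /\<^sub>R real (Suc n)) * exp (b /\<^sub>R real (Suc n))) ^ Suc n) \<longlonglongrightarrow> exp (a + b)"
proof -
  define F where "F h = exp (h *\<^sub>R a) * exp (h *\<^sub>R b) - exp (h *\<^sub>R (a + b))" for h :: real
  have "(F has_vector_derivative
      (exp (0 *\<^sub>R a) * (exp (0 *\<^sub>R b) * b) + (exp (0 *\<^sub>R a) * a) * exp (0 *\<^sub>R b)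
        - exp (0 *\<^sub>R (a + b)) * (a + b))) (at 0)"
    unfolding F_def
    by (intro has_vector_derivative_diff has_vector_derivative_mult exp_scaleR_has_vector_derivative_right)
  then have "(F has_vector_derivative 0) (at 0)" by simp
  then have "((\<lambda>h. norm (F h) / \<bar>h\<bar>) \<longlongrightarrow> 0) (at 0)"
    by (simp add: has_vector_derivative_def has_derivative_at F_def[of 0])
  moreover have "filterlim (\<lambda>n. inverse (real (Suc n))) (at 0) sequentially"
    using LIMSEQ_inverse_real_of_nat by (auto simp: filterlim_at)
  ultimately have lim: "(\<lambda>n. norm (F (inverse (real (Suc n)))) / \<bar>inverse (real (Suc n))\<bar>) \<longlonglongrightarrow> 0"
    by (rule filterlim_compose)
  define c where "c = norm a + norm b"
  have bound: "norm ((exp (a /\<^sub>R real (Suc n)) * exp (b /\<^sub>R real (Suc n))) ^ Suc n - exp (a + b))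
      \<le> exp c * (norm (F (inverse (real (Suc n)))) / \<bar>inverse (real (Suc n))\<bar>)" for n
  proof -
    define h where "h = inverse (real (Suc n))"
    have h: "0 < h" "real (Suc n) * h = 1" by (simp_all add: h_def)
    have e: "exp (a + b) = exp (h *\<^sub>R (a + b)) ^ Suc n"
      by (subst exp_scaleR_of_nat[symmetric]) (simp only: scaleR_scaleR h(2) scaleR_one)
    have n1: "norm (exp (h *\<^sub>R x)) \<le> exp (h * norm x)" for x :: 'a
      using norm_exp[of "h *\<^sub>R x"] h by simp
    have "norm (exp (h *\<^sub>R a) * exp (h *\<^sub>R b)) \<le> exp (h * norm a) * exp (h * norm b)"
      by (rule order_trans[OF norm_mult_ineq mult_mono[OF n1 n1]]) simp_all
    then have A: "norm (exp (h *\<^sub>R a) * exp (h *\<^sub>R b)) \<le> exp (h * c)"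
      by (simp add: c_def distrib_left exp_add)
    have "h * norm (a + b) \<le> h * c"
      using h unfolding c_def by (intro mult_left_mono norm_triangle_ineq) simp
    with n1[of "a + b"] have B: "norm (exp (h *\<^sub>R (a + b))) \<le> exp (h * c)"
      by (meson exp_le_cancel_iff order_trans)
    have "norm ((exp (h *\<^sub>R a) * exp (h *\<^sub>R b)) ^ Suc n - exp (h *\<^sub>R (a + b)) ^ Suc n)
        \<le> real (Suc n) * exp (h * c) ^ Suc n * norm (F h)"
      unfolding F_def using A B h by (intro norm_power_diff_le) (auto simp: c_def)
    also have "exp (h * c) ^ Suc n = exp c"
      by (simp only: exp_of_nat_mult[symmetric] mult.assoc[symmetric] h(2) mult_1)
    also have "real (Suc n) = 1 / \<bar>h\<bar>" using h by (simp add: h_def field_simps)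
    finally show ?thesis unfolding e h_def[symmetric] by (simp add: mult.commute)
  qed
  have "(\<lambda>n. (exp (a /\<^sub>R real (Suc n)) * exp (b /\<^sub>R real (Suc n))) ^ Suc n - exp (a + b)) \<longlonglongrightarrow> 0"
  proof (rule Lim_null_comparison[OF always_eventually])
    show "\<forall>n. norm ((exp (a /\<^sub>R real (Suc n)) * exp (b /\<^sub>R real (Suc n))) ^ Suc n - exp (a + b))
      \<le> exp c * (norm (F (inverse (real (Suc n)))) / \<bar>inverse (real (Suc n))\<bar>)"
      using bound by blast
    show "(\<lambda>n. exp c * (norm (F (inverse (real (Suc n)))) / \<bar>inverse (real (Suc n))\<bar>)) \<longlonglongrightarrow> 0"
      using tendsto_mult_left[OF lim, of "exp c"] by simp
  qed
  then show ?thesis by (rule LIM_zero_cancel)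
qed

text \<open>Along the subsequence of exponents \<open>2 ^ k\<close> the Lie products satisfy the
  first inequality of \<open>tr_power_ineqs\<close>, whose right-hand side is then the same for
  every \<open>k\<close>. The bound survives in the limit.\<close>

lemma Golden_Thompson:
  assumes "selfadj S" "selfadj T"
  shows "tr (exp (S + T)) \<le> tr (exp S * exp T)"
proof -
  define f where "f n = (exp (S /\<^sub>R real n) * exp (T /\<^sub>R real n)) ^ n" for n :: nat
  have "(\<lambda>n. f (Suc n)) \<longlonglongrightarrow> exp (S + T)"
    unfolding f_def by (rule Lie_product_formula)
  then have "f \<longlonglongrightarrow> exp (S + T)"
    by (rule LIMSEQ_imp_Suc)
  moreover have "strict_mono (\<lambda>k::nat. 2 ^ k :: nat)"
    by (simp add: strict_mono_def)
  ultimately have "(\<lambda>k. f (2 ^ k)) \<longlonglongrightarrow> exp (S + T)"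
    using LIMSEQ_subseq_LIMSEQ[of f "exp (S + T)" "\<lambda>k. 2 ^ k"] by (simp add: o_def)
  then have "(\<lambda>k. tr (f (2 ^ k))) \<longlonglongrightarrow> tr (exp (S + T))"
    by (rule bounded_linear.tendsto[OF bounded_linear_tr])
  moreover have "tr (f (2 ^ k)) \<le> tr (exp S * exp T)" for k
  proof -
    have e: "exp (R /\<^sub>R real (2 ^ k)) ^ 2 ^ k = exp R" for R :: "'a endo"
      by (subst exp_scaleR_of_nat[symmetric]) simp
    have "tr (f (2 ^ k)) \<le> tr (exp (S /\<^sub>R real (2 ^ k)) ^ 2 ^ k * exp (T /\<^sub>R real (2 ^ k)) ^ 2 ^ k)"
      unfolding f_def using tr_power_ineqs[of k] assms by (blast intro: selfadj_exp selfadj_scaleR)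
    then show ?thesis by (simp only: e)
  qed
  ultimately show ?thesis
    by (intro LIMSEQ_le_const2) auto
qed

section \<open>Second-order bounds for the operator exponential\<close>

text \<open>On the unit interval \<open>f'\<close> is nondecreasing, hence at least
  \<open>f' 0\<close>, and so \<open>f\<close> minus its tangent at 0 is nondecreasing.\<close>

lemma second_order_lower_bound:
  fixes f f' f'' :: "real \<Rightarrow> real"
  assumes f: "\<And>u. (f has_real_derivative f' u) (at u)"
    and f': "\<And>u. (f' has_real_derivative f'' u) (at u)"
    and nonneg: "\<And>u. 0 \<le> u \<Longrightarrow> u \<le> 1 \<Longrightarrow> 0 \<le> f'' u"
  shows "f 0 + f' 0 \<le> f 1"
proof -
  have mono: "f' 0 \<le> f' u" if "0 \<le> u" "u \<le> 1" for u
    using that f' nonneg by (intro DERIV_nonneg_imp_nondecreasing[of 0 u f']) force+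
  have "f 0 - f' 0 * 0 \<le> f 1 - f' 0 * 1"
  proof (rule DERIV_nonneg_imp_nondecreasing[where f = "\<lambda>u. f u - f' 0 * u"])
    fix u :: real assume u: "0 \<le> u" "u \<le> 1"
    have "((\<lambda>u. f u - f' 0 * u) has_real_derivative f' u - f' 0) (at u)"
      by (auto intro!: derivative_eq_intros f)
    then show "\<exists>y. ((\<lambda>u. f u - f' 0 * u) has_real_derivative y) (at u) \<and> 0 \<le> y"
      using mono[OF u] by fastforce
  qed simp
  then show ?thesis by simp
qed

text \<open>The second derivative is written with one \<open>S\<close> on each side of the
  exponential, so that it has the form of a congruence when \<open>S\<close> is
  self-adjoint.\<close>

lemma bounded_linear_exp_derivs:
  fixes S :: "'a::{real_normed_algebra_1,banach}" and l :: "'a \<Rightarrow> real"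
  assumes "bounded_linear l"
  shows "((\<lambda>u. l (exp (u *\<^sub>R S))) has_real_derivative l (S * exp (u *\<^sub>R S))) (at u)"
    and "((\<lambda>u. l (S * exp (u *\<^sub>R S))) has_real_derivative l (S * exp (u *\<^sub>R S) * S)) (at u)"
proof -
  have l': "bounded_linear (\<lambda>T. l (S * T))"
    by (rule bounded_linear_compose[OF assms bounded_linear_mult_right])
  show "((\<lambda>u. l (exp (u *\<^sub>R S))) has_real_derivative l (S * exp (u *\<^sub>R S))) (at u)"
    using bounded_linear.has_vector_derivative[OF assms exp_scaleR_has_vector_derivative_left[of S u]]
    by (simp add: has_real_derivative_iff_has_vector_derivative)
  show "((\<lambda>u. l (S * exp (u *\<^sub>R S))) has_real_derivative l (S * exp (u *\<^sub>R S) * S)) (at u)"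
    using bounded_linear.has_vector_derivative[OF l' exp_scaleR_has_vector_derivative_right[of S u]]
    by (simp add: has_real_derivative_iff_has_vector_derivative mult.assoc)
qed

lemma exp_second_order:
  fixes S :: "'a::{real_normed_algebra_1,banach}" and l :: "'a \<Rightarrow> real"
  assumes l: "bounded_linear l"
    and nonneg: "\<And>u. 0 \<le> u \<Longrightarrow> u \<le> 1 \<Longrightarrow> 0 \<le> l (S * exp (u *\<^sub>R S) * S)"
  shows "0 \<le> l (exp S - 1 - S)"
  using second_order_lower_bound[OF bounded_linear_exp_derivs[OF l] nonneg]
    bounded_linear.linear[OF l]
  by (simp add: linear_diff)

text \<open>Supplies the square root of an exponential, which turns products with \<open>exp\<close>
  into congruences.\<close>

lemma exp_half_square: "exp (u *\<^sub>R S) = exp ((u/2) *\<^sub>R S) * exp ((u/2) *\<^sub>R S)"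
  for S :: "'a::{real_normed_algebra_1,banach}"
  by (subst exp_add_commuting[symmetric]) (simp_all flip: scaleR_add_left)

lemma psd_exp:
  assumes "selfadj S"
  shows "psd (exp S)"
proof -
  have "psd (exp ((1/2) *\<^sub>R S) * 1 * exp ((1/2) *\<^sub>R S))"
    using assms by (intro psd_congruence selfadj_exp selfadj_scaleR) (simp add: psd_def)
  then show ?thesis
    using exp_half_square[of 1 S] by simp
qed

lemma psd_exp_remainder:
  assumes "selfadj S"
  shows "psd (exp S - 1 - S)"
  unfolding psd_def
proof
  fix x
  show "0 \<le> app (exp S - 1 - S) x \<bullet> x"
  proof (rule exp_second_order[OF bounded_linear_app_inner])
    fix u :: real
    have "psd (S * exp (u *\<^sub>R S) * S)"
      using assms by (intro psd_congruence psd_exp selfadj_scaleR)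
    then show "0 \<le> app (S * exp (u *\<^sub>R S) * S) x \<bullet> x"
      by (simp add: psd_def)
  qed
qed

text \<open>With \<open>E\<close> the square root of \<open>exp (u S)\<close>, the second derivative
  \<open>tr (Q S E E S)\<close> rotates to \<open>tr (E (S Q S) E)\<close>, the trace of a repeated
  congruence of \<open>Q\<close>.\<close>

lemma tr_mult_exp_remainder_nonneg:
  assumes "psd Q" "selfadj S"
  shows "0 \<le> tr (Q * (exp S - 1 - S))"
proof (rule exp_second_order[OF bounded_linear_tr_mult])
  fix u :: real
  let ?E = "exp ((u/2) *\<^sub>R S)"
  have E: "selfadj ?E"
    using assms by (intro selfadj_exp selfadj_scaleR)
  have "tr (Q * (S * exp (u *\<^sub>R S) * S)) = tr (Q * S * ?E * (?E * S))"
    by (simp only: exp_half_square[of u S] mult.assoc)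
  also have "\<dots> = tr (?E * (S * Q * S) * ?E)"
    by (subst tr_commute) (simp add: mult.assoc)
  also have "0 \<le> \<dots>"
    using assms E by (intro tr_nonneg psd_congruence)
  finally show "0 \<le> tr (Q * (S * exp (u *\<^sub>R S) * S))" .
qed

lemma tr_exp_mult_nonneg:
  assumes "psd Q" "selfadj S"
  shows "0 \<le> tr (exp S * Q)"
proof -
  let ?E = "exp ((1/2) *\<^sub>R S)"
  have "tr (exp S * Q) = tr (?E * (?E * Q))"
    using exp_half_square[of 1 S] by (simp add: mult.assoc)
  also have "\<dots> = tr (?E * Q * ?E)"
    by (rule tr_commute)
  also have "0 \<le> \<dots>"
    using assms by (intro tr_nonneg psd_congruence selfadj_exp selfadj_scaleR)
  finally show ?thesis .
qed

text \<open>The second derivative of the quadratic form of \<open>exp (u Y)\<close> at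
  \<open>x\<close> is the form of \<open>exp (u Y)\<close> at \<open>w = app Y x\<close>, hence at
  most \<open>exp L\<close> times the squared norm of \<open>w\<close>. The estimate
  \<open>exp L \<le> 1 / (1 - L)\<close> gives the coefficient that produces a Bernstein-type
  tail.\<close>

lemma exp_quadratic_upper_bound:
  assumes Y: "selfadj Y" and L: "norm Y \<le> L" "L < 1"
  shows "psd (1 + Y + (1 / (2 * (1 - L))) *\<^sub>R (Y * Y) - exp Y)"
  unfolding psd_def
proof
  fix x
  define w where "w = app Y x"
  define f where "f u = app (exp (u *\<^sub>R Y)) x \<bullet> x" for u
  define f' where "f' u = app (Y * exp (u *\<^sub>R Y)) x \<bullet> x" for u
  define f'' where "f'' u = app (Y * exp (u *\<^sub>R Y) * Y) x \<bullet> x" for u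
  define K where "K = (norm w)\<^sup>2 / (1 - L)"
  have L0: "0 \<le> L" using L(1) norm_ge_zero order_trans by blast
  have d: "(f has_real_derivative f' u) (at u)" "(f' has_real_derivative f'' u) (at u)" for u
    unfolding f_def f'_def f''_def
    using bounded_linear_exp_derivs[OF bounded_linear_app_inner] by auto
  have "f'' u \<le> K" if u: "0 \<le> u" "u \<le> 1" for u
  proof -
    have "f'' u = app (exp (u *\<^sub>R Y)) w \<bullet> w"
      using selfadjD[OF Y] by (simp add: f''_def w_def)
    also have "\<dots> \<le> norm (app (exp (u *\<^sub>R Y)) w) * norm w"
      by (rule norm_cauchy_schwarz)
    also have "\<dots> \<le> norm (exp (u *\<^sub>R Y)) * norm w * norm w"
      by (intro mult_right_mono norm_app) simp
    also have "norm (exp (u *\<^sub>R Y)) \<le> exp L"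
    proof -
      have "norm (u *\<^sub>R Y) \<le> 1 * L"
        unfolding norm_scaleR using u L by (intro mult_mono) auto
      with norm_exp[of "u *\<^sub>R Y"] show ?thesis
        by (smt (verit) exp_le_cancel_iff)
    qed
    also have "exp L \<le> 1 / (1 - L)"
    proof -
      have "1 - L \<le> exp (- L)" using exp_ge_add_one_self[of "- L"] by simp
      then show ?thesis using L(2) by (simp add: exp_minus field_simps)
    qed
    finally show ?thesis
      by (simp add: K_def power2_eq_square mult_right_mono)
  qed
  \<comment> \<open>The upper bound on \<open>f\<close> is the lower bound for the convex function
    \<open>K * u\<^sup>2 / 2 - f u\<close>.\<close>
  then have "(K * 0\<^sup>2 / 2 - f 0) + (K * 0 - f' 0) \<le> K * 1\<^sup>2 / 2 - f 1"
    by (intro second_order_lower_bound[where f = "\<lambda>u. K * u\<^sup>2 / 2 - f u"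
          and f' = "\<lambda>u. K * u - f' u" and f'' = "\<lambda>u. K - f'' u"])
       (auto intro!: derivative_eq_intros d)
  then show "0 \<le> app (1 + Y + (1 / (2 * (1 - L))) *\<^sub>R (Y * Y) - exp Y) x \<bullet> x"
    using selfadjD[OF Y, of "app Y x" x]
    by (simp add: f_def f'_def K_def w_def inner_add_left inner_diff_left power2_norm_eq_inner mult.commute[of L])
qed

text \<open>Jensen's inequality for the exponential at a unit vector. Factor out the scalar
  \<open>exp c\<close> with \<open>c\<close> the value of the form; the remaining operator
  \<open>S - c\<close> has form 0 at \<open>x\<close>, so \<open>exp T \<ge> 1 + T\<close> leaves at
  least 1.\<close>

lemma exp_inner_le:
  assumes S: "selfadj S" and x: "norm x = 1"
  shows "exp (app S x \<bullet> x) \<le> app (exp S) x \<bullet> x"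
proof -
  define c where "c = app S x \<bullet> x"
  have xx: "x \<bullet> x = 1" using x by (simp add: dot_square_norm)
  have "exp S = exp (c *\<^sub>R 1 + (S - c *\<^sub>R 1))"
    by simp
  also have "\<dots> = exp (c *\<^sub>R 1) * exp (S - c *\<^sub>R 1)"
    by (rule exp_add_commuting) (simp add: algebra_simps)
  also have "exp (c *\<^sub>R 1) = (exp c *\<^sub>R 1 :: 'a endo)"
    using exp_of_real[of c, where 'a = "'a endo"] by (simp add: of_real_def)
  finally have e: "app (exp S) x \<bullet> x = exp c * (app (exp (S - c *\<^sub>R 1)) x \<bullet> x)"
    by simp
  have "psd (exp (S - c *\<^sub>R 1) - 1 - (S - c *\<^sub>R 1))"
    using S by (intro psd_exp_remainder selfadj_diff selfadj_scaleR) simp_all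
  then have "0 \<le> app (exp (S - c *\<^sub>R 1) - 1 - (S - c *\<^sub>R 1)) x \<bullet> x"
    by (simp add: psd_def)
  then have "1 \<le> app (exp (S - c *\<^sub>R 1)) x \<bullet> x"
    using xx by (simp add: inner_diff_left c_def)
  then show ?thesis
    unfolding e c_def[symmetric] by simp
qed

text \<open>With \<open>R\<close> the orthogonal projection onto the line of \<open>x\<close>, the
  form of \<open>?P\<close> at \<open>x\<close> is \<open>tr (R * ?P)\<close>. Since
  \<open>1 - R\<close> is psd, this is at most the full trace, and \<open>exp_inner_le\<close>
  bounds it below.\<close>

lemma tr_exp_remainder_ge:
  assumes S: "selfadj S" and x: "norm x = 1"
  shows "exp (app S x \<bullet> x) - 1 - app S x \<bullet> x \<le> tr (exp S - 1 - S)"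
proof -
  let ?P = "exp S - 1 - S"
  define R where "R = endo_of (\<lambda>y. (x \<bullet> y) *\<^sub>R x)"
  have xx: "x \<bullet> x = 1" using x by (simp add: dot_square_norm)
  have R: "app R y = (x \<bullet> y) *\<^sub>R x" for y
    unfolding R_def
    by (subst app_endo_of) (auto intro!: linearI simp: inner_add_right scaleR_add_left)
  have "tr (R * ?P) = (\<Sum>b\<in>Basis. (x \<bullet> b) * (x \<bullet> app ?P b))"
    unfolding tr_def by (simp add: R mult.commute)
  also have "\<dots> = x \<bullet> app ?P (\<Sum>b\<in>Basis. (x \<bullet> b) *\<^sub>R b)"
    unfolding linear_sum[OF linear_app] linear_scale[OF linear_app]
    by (simp only: inner_sum_right inner_scaleR_right)
  also have "\<dots> = app ?P x \<bullet> x"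
    unfolding euclidean_representation by (rule inner_commute)
  finally have trR: "tr (R * ?P) = app ?P x \<bullet> x" .
  have "psd (1 - R)"
    unfolding psd_def
  proof
    fix y
    have "(x \<bullet> y)\<^sup>2 \<le> (x \<bullet> x) * (y \<bullet> y)" by (rule Cauchy_Schwarz_ineq)
    then show "0 \<le> app (1 - R) y \<bullet> y"
      by (simp add: R xx inner_diff_left power2_eq_square)
  qed
  from tr_mult_exp_remainder_nonneg[OF this S] have "app ?P x \<bullet> x \<le> tr ?P"
    by (simp add: left_diff_distrib tr_diff trR del: app_diff)
  with exp_inner_le[OF S x] show ?thesis
    by (simp add: inner_diff_left xx)
qed

section \<open>The trace exponential along a random walk of operators\<close>

text \<open>For a probability vector \<open>p\<close> this is the expectation of \<open>g\<close> at
  the position, after \<open>k\<close> independent steps \<open>Y i\<close> with \<open>i\<close>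
  drawn from \<open>p\<close>, of a walk started at \<open>z\<close>. The recursion averages inside
  \<open>g\<close>, so a bound on one step from an arbitrary position applies directly to the last
  step.\<close>

primrec walk_expectation ::
    "('i::finite \<Rightarrow> real) \<Rightarrow> ('i \<Rightarrow> 's::ab_group_add) \<Rightarrow> nat \<Rightarrow> ('s \<Rightarrow> real) \<Rightarrow> 's \<Rightarrow> real" where
  "walk_expectation p Y 0 g z = g z"
| "walk_expectation p Y (Suc k) g z = walk_expectation p Y k (\<lambda>z. \<Sum>i\<in>UNIV. p i * g (z + Y i)) z"

lemma walk_expectation_mono:
  assumes "\<And>i. 0 \<le> p i" and "\<And>z i. Q z \<Longrightarrow> Q (z + Y i)" and "\<And>z. Q z \<Longrightarrow> f z \<le> g z" and "Q z"
  shows "walk_expectation p Y k f z \<le> walk_expectation p Y k g z"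
  using assms(3,4)
proof (induction k arbitrary: f g)
  case (Suc k)
  then show ?case
    by (auto intro!: Suc.IH sum_mono mult_left_mono simp: assms(1,2))
qed simp

lemma walk_expectation_affine:
  assumes "(\<Sum>i\<in>UNIV. p i) = 1"
  shows "walk_expectation p Y k (\<lambda>z. a * f z + b * g z + c) z
    = a * walk_expectation p Y k f z + b * walk_expectation p Y k g z + c"
proof (induction k arbitrary: f g)
  case (Suc k)
  have "(\<Sum>i\<in>UNIV. p i * (a * f (z + Y i) + b * g (z + Y i) + c))
      = a * (\<Sum>i\<in>UNIV. p i * f (z + Y i)) + b * (\<Sum>i\<in>UNIV. p i * g (z + Y i)) + c" for z
    using assms by (simp add: algebra_simps sum.distrib sum_distrib_left flip: sum_distrib_left[of c])
  then show ?case by (simp add: Suc)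
qed simp

lemma walk_expectation_martingale:
  assumes "(\<Sum>i\<in>UNIV. p i) = 1" and add: "\<And>x y. l (x + y) = l x + l y"
    and mean: "(\<Sum>i\<in>UNIV. p i * l (Y i)) = 0"
  shows "walk_expectation p Y k l z = l z"
proof (induction k)
  case (Suc k)
  have "(\<lambda>z. \<Sum>i\<in>UNIV. p i * l (z + Y i)) = l"
    using assms by (simp add: add algebra_simps sum.distrib flip: sum_distrib_left)
  then show ?case by (simp add: Suc)
qed simp

text \<open>Used twice: to rescale an operator walk and to carry the walk of matrices over to the
  walk of their dilations.\<close>

lemma walk_expectation_map:
  assumes "\<And>x y. D (x + y) = D x + D y"
  shows "walk_expectation p (\<lambda>i. D (Y i)) k g (D z) = walk_expectation p Y k (\<lambda>z. g (D z)) z"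
  by (induction k arbitrary: g) (simp_all add: assms)

definition tr_exp_remainder :: "'a::euclidean_space endo \<Rightarrow> real" where
  "tr_exp_remainder S = tr (exp S - 1 - S)"

locale operator_walk =
  fixes p :: "'i::finite \<Rightarrow> real" and Y :: "'i \<Rightarrow> 'a::euclidean_space endo" and L v :: real
  assumes p_nonneg: "\<And>i. 0 \<le> p i" and p_sum: "(\<Sum>i\<in>UNIV. p i) = 1"
    and Y_selfadj: "\<And>i. selfadj (Y i)"
    and Y_mean: "(\<Sum>i\<in>UNIV. p i *\<^sub>R Y i) = 0"
    and Y_norm: "\<And>i. norm (Y i) \<le> L"
    and v_pos: "0 < v"
    and Y_var: "psd (v *\<^sub>R 1 - (\<Sum>i\<in>UNIV. p i *\<^sub>R (Y i * Y i)))"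
begin

definition V :: "'a endo" where
  "V = (\<Sum>i\<in>UNIV. p i *\<^sub>R (Y i * Y i))"

lemma tr_mult_sum: "(\<Sum>i\<in>UNIV. p i * tr (S * f i)) = tr (S * (\<Sum>i\<in>UNIV. p i *\<^sub>R f i))"
  by (simp add: sum_distrib_left tr_sum tr_scaleR)

lemma tr_V_nonneg: "0 \<le> tr V"
  unfolding V_def tr_sum tr_scaleR
proof (intro sum_nonneg mult_nonneg_nonneg p_nonneg)
  fix i show "0 \<le> tr (Y i * Y i)"
    using tr_mult_adj_nonneg[of "Y i"] by (simp add: adj_eq_selfadj Y_selfadj)
qed

lemma step_bound:
  assumes S: "selfadj S" and "L < 1"
  defines "g \<equiv> 1 / (2 * (1 - L))"
  shows "(\<Sum>i\<in>UNIV. p i * tr_exp_remainder (S + Y i)) \<le> (1 + g * v) * tr_exp_remainder S + g * tr (V * S) + g * tr V"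
proof -
  have g: "0 \<le> g" using \<open>L < 1\<close> by (simp add: g_def)
  have "tr (exp (S + Y i)) \<le> tr (exp S) + tr (exp S * Y i) + g * tr (exp S * (Y i * Y i))" for i
  proof -
    have "tr (exp (S + Y i)) \<le> tr (exp S * exp (Y i))"
      by (rule Golden_Thompson[OF S Y_selfadj])
    moreover have "0 \<le> tr (exp S * (1 + Y i + g *\<^sub>R (Y i * Y i) - exp (Y i)))"
      unfolding g_def
      by (intro tr_exp_mult_nonneg exp_quadratic_upper_bound S Y_selfadj Y_norm \<open>L < 1\<close>)
    ultimately show ?thesis
      by (simp add: distrib_left right_diff_distrib tr_add tr_diff tr_scaleR)
  qed
  then have "(\<Sum>i\<in>UNIV. p i * tr (exp (S + Y i)))
      \<le> (\<Sum>i\<in>UNIV. p i * (tr (exp S) + tr (exp S * Y i) + g * tr (exp S * (Y i * Y i))))"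
    by (intro sum_mono mult_left_mono p_nonneg)
  also have "\<dots> = (\<Sum>i\<in>UNIV. p i) * tr (exp S) + (\<Sum>i\<in>UNIV. p i * tr (exp S * Y i))
      + g * (\<Sum>i\<in>UNIV. p i * tr (exp S * (Y i * Y i)))"
    by (simp add: algebra_simps sum.distrib sum_distrib_left sum_distrib_right)
  also have "\<dots> = tr (exp S) + g * tr (V * exp S)"
    unfolding tr_mult_sum by (simp add: p_sum Y_mean V_def tr_commute[of "exp S"])
  finally have 1: "(\<Sum>i\<in>UNIV. p i * tr (exp (S + Y i))) \<le> tr (exp S) + g * tr (V * exp S)" .
  have "(\<Sum>i\<in>UNIV. p i * tr (Y i)) = 0"
    using tr_mult_sum[of 1 Y] by (simp add: Y_mean)
  then have "(\<Sum>i\<in>UNIV. p i * tr_exp_remainder (S + Y i))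
      = (\<Sum>i\<in>UNIV. p i * tr (exp (S + Y i))) - (\<Sum>i\<in>UNIV. p i) * (tr (1 :: 'a endo) + tr S)"
    by (simp add: tr_exp_remainder_def tr_diff tr_add algebra_simps sum.distrib sum_subtractf sum_distrib_left sum_distrib_right)
  with 1 have 2: "(\<Sum>i\<in>UNIV. p i * tr_exp_remainder (S + Y i)) \<le> tr_exp_remainder S + g * tr (V * exp S)"
    by (simp add: p_sum tr_exp_remainder_def tr_diff)
  \<comment> \<open>The operator bound \<open>V \<le> v\<close> is traded against the psd remainder
    only. The parts 1 and \<open>S\<close> of \<open>exp S\<close> keep the weight \<open>V\<close>,
    giving \<open>tr V\<close> instead of \<open>v\<close> times the dimension.\<close>
  have "0 \<le> tr ((v *\<^sub>R 1 - V) * (exp S - 1 - S))"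
    unfolding V_def by (rule tr_mult_exp_remainder_nonneg[OF Y_var S])
  also have "\<dots> = v * tr_exp_remainder S - tr (V * (exp S - 1 - S))"
    by (simp only: left_diff_distrib tr_diff mult_scaleR_left mult_1_left tr_scaleR tr_exp_remainder_def)
  also have "\<dots> = v * tr_exp_remainder S - tr (V * exp S) + tr V + tr (V * S)"
    by (simp add: right_diff_distrib tr_diff)
  finally have "tr (V * exp S) \<le> v * tr_exp_remainder S + tr V + tr (V * S)" by simp
  from mult_left_mono[OF this g] 2 show ?thesis
    by (simp add: algebra_simps)
qed

text \<open>After averaging, the term \<open>tr (V * S)\<close> drops out as a martingale started at
  0. What remains is the recursion x' = (1 + g v) x + g \<open>tr V\<close> from x = 0, whose
  solution is the right-hand side.\<close>

lemma walk_tr_exp_remainder_bound: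
  assumes "L < 1"
  defines "g \<equiv> 1 / (2 * (1 - L))"
  shows "walk_expectation p Y k tr_exp_remainder 0 \<le> tr V / v * ((1 + g * v) ^ k - 1)"
proof (induction k)
  case 0
  then show ?case by (simp add: tr_exp_remainder_def)
next
  case (Suc k)
  have g: "0 \<le> g" using \<open>L < 1\<close> by (simp add: g_def)
  have "walk_expectation p Y (Suc k) tr_exp_remainder 0
      \<le> walk_expectation p Y k (\<lambda>S. (1 + g * v) * tr_exp_remainder S + g * tr (V * S) + g * tr V) 0"
    unfolding walk_expectation.simps
    by (rule walk_expectation_mono[where Q = selfadj])
       (use step_bound[OF _ \<open>L < 1\<close>] in \<open>auto simp: p_nonneg Y_selfadj selfadj_add g_def\<close>)
  also have "\<dots> = (1 + g * v) * walk_expectation p Y k tr_exp_remainder 0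
      + g * walk_expectation p Y k (\<lambda>S. tr (V * S)) 0 + g * tr V"
    by (rule walk_expectation_affine[OF p_sum])
  also have "walk_expectation p Y k (\<lambda>S. tr (V * S)) 0 = tr (V * 0)"
    by (rule walk_expectation_martingale[OF p_sum]) (simp_all add: distrib_left tr_add tr_mult_sum Y_mean)
  also have "(1 + g * v) * walk_expectation p Y k tr_exp_remainder 0 + g * tr (V * 0) + g * tr V
      \<le> (1 + g * v) * (tr V / v * ((1 + g * v) ^ k - 1)) + g * tr V"
    using g v_pos Suc mult_left_mono[OF Suc, of "1 + g * v"] by simp
  also have "\<dots> = tr V / v * ((1 + g * v) ^ Suc k - 1)"
    using v_pos by (simp add: field_simps)
  finally show ?case .
qed

end

text \<open>Markov's inequality will give a ratio with \<open>t + c\<close> in the denominator. Its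
  surplus \<open>c\<close> is worth at least a factor \<open>exp c\<close>, which absorbs the one in
  \<open>exp c - 1 \<le> c * exp c\<close>.\<close>

lemma exp_ratio_bound:
  fixes t c :: real
  assumes "0 < t" "0 \<le> c"
  shows "(exp c - 1) / (exp (t + c) - (t + c) - 1) \<le> c / (exp t - t - 1)"
    and "0 < exp (t + c) - (t + c) - 1"
proof -
  have "1 + x < exp x" if "0 < x" for x :: real
    using that exp_minus_greater[of "- x"] exp_minus_ge[of "- x"] by (smt (verit))
  then have pos: "0 < exp x - x - 1" if "0 < x" for x :: real
    using that by (smt (verit))
  show K: "0 < exp (t + c) - (t + c) - 1"
    using assms by (intro pos) simp
  have "(t + 1) * (1 + c) \<le> (t + 1) * exp c"
    using assms exp_ge_add_one_self[of c] by (intro mult_left_mono) auto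
  moreover have "0 \<le> t * c" using assms by simp
  ultimately have 1: "exp c * (exp t - t - 1) \<le> exp (t + c) - (t + c) - 1"
    by (simp add: exp_add algebra_simps)
  have "1 - c \<le> exp (- c)" using exp_ge_add_one_self[of "- c"] by simp
  then have "(1 - c) * exp c \<le> exp (- c) * exp c" by (intro mult_right_mono) auto
  then have "exp c - 1 \<le> c * exp c"
    by (simp add: algebra_simps flip: exp_add)
  then have "(exp c - 1) * (exp t - t - 1) \<le> c * exp c * (exp t - t - 1)"
    using pos[OF assms(1)] by (intro mult_right_mono) auto
  also have "\<dots> \<le> c * (exp (t + c) - (t + c) - 1)"
    using 1 assms by (simp add: mult_left_mono mult.assoc)
  finally show "(exp c - 1) / (exp (t + c) - (t + c) - 1) \<le> c / (exp t - t - 1)"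
    using K pos[OF assms(1)] by (simp add: field_simps)
qed

text \<open>Markov's inequality for the trace remainder of \<open>\<theta> *\<^sub>R S\<close>,
  followed by \<open>exp_ratio_bound\<close>.\<close>

lemma (in operator_walk) walk_tail_bound:
  assumes "0 < m" "0 < t"
  shows "walk_expectation p Y m
      (\<lambda>S. of_bool (\<exists>x. norm x = 1 \<and> sqrt (2 * real m * v * t) + L * t < app S x \<bullet> x)) 0
    \<le> tr V / v * (t / (exp t - t - 1))"
proof -
  \<comment> \<open>The parameters make everything explicit:
    \<open>real m * v = 2 * t * r\<^sup>2\<close> turns the threshold into
    \<open>s = 2 * t * r + L * t\<close>, and \<theta> gives both
    \<open>1 - \<theta> * L = \<theta> * r\<close> and \<open>\<theta> * s = t + c\<close>. The
    exponent of the moment bound is then exactly \<open>c\<close>.\<close>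
  define r where "r = sqrt (real m * v / (2 * t))"
  define \<theta> where "\<theta> = 1 / (L + r)"
  define c where "c = \<theta> * r * t"
  define s where "s = sqrt (2 * real m * v * t) + L * t"
  define K where "K = exp (t + c) - (t + c) - 1"
  have L: "0 \<le> L" using Y_norm[of undefined] norm_ge_zero order_trans by blast
  have r: "0 < r" using assms v_pos by (simp add: r_def)
  have mv: "real m * v = 2 * t * r\<^sup>2" using assms v_pos by (simp add: r_def)
  have "2 * real m * v * t = (2 * t * r)\<^sup>2"
    using mv by (simp add: power2_eq_square algebra_simps)
  then have s: "s = 2 * t * r + L * t"
    using assms r by (simp add: s_def)
  have \<theta>: "0 < \<theta>" "\<theta> * (L + r) = 1" using L r by (simp_all add: \<theta>_def)
  have \<theta>L: "1 - \<theta> * L = \<theta> * r" using \<theta>(2) by (simp add: algebra_simps)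
  have "0 < \<theta> * r" using \<theta> r by simp
  then have \<theta>L1: "\<theta> * L < 1" using \<theta>L by simp
  have c: "0 \<le> c" using \<theta> r assms by (simp add: c_def)
  have "\<theta> * r \<le> 1" using \<theta>L \<theta> L by (smt (verit) mult_nonneg_nonneg)
  then have ct: "c \<le> t" using assms mult_right_mono[of "\<theta> * r" 1 t] by (simp add: c_def)
  have "\<theta> * s = \<theta> * (L + r) * t + \<theta> * r * t"
    by (simp add: s algebra_simps)
  then have \<theta>s: "\<theta> * s = t + c"
    unfolding \<theta>(2) c_def by simp
  have K: "0 < K" unfolding K_def by (rule exp_ratio_bound(2)[OF \<open>0 < t\<close> c])
  \<comment> \<open>Scaling multiplies \<open>V\<close> and \<open>v\<close> by the same factor, so
    the ratio \<open>tr V / v\<close> is unaffected, while the step bound falls below 1.\<close>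
  interpret scaled: operator_walk p "\<lambda>i. \<theta> *\<^sub>R Y i" "\<theta> * L" "\<theta>\<^sup>2 * v"
  proof
    show "(\<Sum>i\<in>UNIV. p i *\<^sub>R \<theta> *\<^sub>R Y i) = 0"
      using arg_cong[OF Y_mean, of "\<lambda>S. \<theta> *\<^sub>R S"] by (simp add: scaleR_sum_right mult.commute)
    show "norm (\<theta> *\<^sub>R Y i) \<le> \<theta> * L" for i
      using \<theta> Y_norm by (simp add: mult_left_mono)
    have "(\<theta>\<^sup>2 * v) *\<^sub>R 1 - (\<Sum>i\<in>UNIV. p i *\<^sub>R (\<theta> *\<^sub>R Y i * \<theta> *\<^sub>R Y i))
        = \<theta>\<^sup>2 *\<^sub>R (v *\<^sub>R 1 - (\<Sum>i\<in>UNIV. p i *\<^sub>R (Y i * Y i)))"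
      by (simp add: scaleR_diff_right scaleR_sum_right power2_eq_square ac_simps)
    with Y_var show "psd ((\<theta>\<^sup>2 * v) *\<^sub>R 1 - (\<Sum>i\<in>UNIV. p i *\<^sub>R (\<theta> *\<^sub>R Y i * \<theta> *\<^sub>R Y i)))"
      unfolding psd_def by (simp del: app_diff app_sum)
  qed (use \<theta> v_pos in \<open>auto simp: p_nonneg p_sum Y_selfadj selfadj_scaleR\<close>)
  have scaled_V: "scaled.V = \<theta>\<^sup>2 *\<^sub>R V"
    by (simp add: scaled.V_def V_def scaleR_sum_right power2_eq_square ac_simps)
  have ind: "of_bool (\<exists>x. norm x = 1 \<and> s < app S x \<bullet> x) \<le> (1 / K) * tr_exp_remainder (\<theta> *\<^sub>R S)"
    if S: "selfadj S" for S
  proof -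
    have S': "selfadj (\<theta> *\<^sub>R S)" using S by (rule selfadj_scaleR)
    show ?thesis
    proof (cases "\<exists>x. norm x = 1 \<and> s < app S x \<bullet> x")
      case True
      then obtain x where x: "norm x = 1" "s < app S x \<bullet> x" by blast
      define y where "y = app (\<theta> *\<^sub>R S) x \<bullet> x"
      have y: "t + c \<le> y"
        using x(2) \<theta> by (simp add: y_def flip: \<theta>s)
      \<comment> \<open>The function exp y - 1 - y takes the value \<open>K\<close> at
        \<open>t + c\<close>; the tangent of exp at that point shows that it does not fall below
        \<open>K\<close> further right.\<close>
      have "exp (t + c) * (1 + (y - (t + c))) \<le> exp (t + c) * exp (y - (t + c))"
        using exp_ge_add_one_self[of "y - (t + c)"] by (intro mult_left_mono) auto
      also have "\<dots> = exp y" by (simp flip: exp_add)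
      finally have "exp (t + c) + exp (t + c) * (y - (t + c)) \<le> exp y"
        by (simp add: algebra_simps)
      moreover have "1 * (y - (t + c)) \<le> exp (t + c) * (y - (t + c))"
        using y c assms by (intro mult_right_mono) auto
      ultimately have "K \<le> exp y - 1 - y"
        by (simp add: K_def)
      also have "\<dots> \<le> tr_exp_remainder (\<theta> *\<^sub>R S)"
        unfolding tr_exp_remainder_def y_def by (rule tr_exp_remainder_ge[OF S' x(1)])
      finally show ?thesis using K True by (simp add: field_simps)
    next
      case False
      have "0 \<le> tr_exp_remainder (\<theta> *\<^sub>R S)"
        unfolding tr_exp_remainder_def by (intro tr_nonneg psd_exp_remainder S')
      with False K show ?thesis by auto
    qed
  qed
  have "walk_expectation p Y m (\<lambda>S. of_bool (\<exists>x. norm x = 1 \<and> s < app S x \<bullet> x)) 0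
      \<le> walk_expectation p Y m (\<lambda>S. (1 / K) * tr_exp_remainder (\<theta> *\<^sub>R S)) 0"
    by (rule walk_expectation_mono[where Q = selfadj])
       (rule p_nonneg selfadj_add Y_selfadj ind selfadj_0 | assumption)+
  also have "\<dots> = (1 / K) * walk_expectation p Y m (\<lambda>S. tr_exp_remainder (\<theta> *\<^sub>R S)) 0"
    using walk_expectation_affine[OF p_sum, of Y m "1/K" "\<lambda>S. tr_exp_remainder (\<theta> *\<^sub>R S)" 0 "\<lambda>_. 0" 0 0] by simp
  also have "walk_expectation p Y m (\<lambda>S. tr_exp_remainder (\<theta> *\<^sub>R S)) 0
      = walk_expectation p (\<lambda>i. \<theta> *\<^sub>R Y i) m tr_exp_remainder 0"
    using walk_expectation_map[of "\<lambda>S. \<theta> *\<^sub>R S" p Y m tr_exp_remainder 0]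
    by (simp add: scaleR_add_right)
  also have "\<dots> \<le> tr V / v * (exp c - 1)"
  proof -
    define g where "g = 1 / (2 * (1 - \<theta> * L))"
    have "walk_expectation p (\<lambda>i. \<theta> *\<^sub>R Y i) m tr_exp_remainder 0
        \<le> tr scaled.V / (\<theta>\<^sup>2 * v) * ((1 + g * (\<theta>\<^sup>2 * v)) ^ m - 1)"
      unfolding g_def by (rule scaled.walk_tr_exp_remainder_bound[OF \<theta>L1])
    also have "tr scaled.V / (\<theta>\<^sup>2 * v) = tr V / v"
      using \<theta> by (simp add: scaled_V tr_scaleR)
    also have "(1 + g * (\<theta>\<^sup>2 * v)) ^ m \<le> exp c"
    proof -
      have "0 \<le> g" using \<theta>L1 by (simp add: g_def)
      then have "(1 + g * (\<theta>\<^sup>2 * v)) ^ m \<le> exp (g * (\<theta>\<^sup>2 * v)) ^ m"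
        using v_pos by (intro power_mono) auto
      also have "\<dots> = exp (g * \<theta>\<^sup>2 * (real m * v))"
        by (simp add: ac_simps flip: exp_of_nat_mult)
      also have "g * \<theta>\<^sup>2 * (real m * v) = c"
        using \<theta> r unfolding g_def \<theta>L mv c_def by (simp add: field_simps power2_eq_square)
      finally show ?thesis .
    qed
    finally show ?thesis
      using tr_V_nonneg v_pos by (simp add: mult_left_mono divide_right_mono)
  qed
  also have "(1 / K) * (tr V / v * (exp c - 1)) = tr V / v * ((exp c - 1) / K)"
    by simp
  also have "\<dots> \<le> tr V / v * (c / (exp t - t - 1))"
    unfolding K_def using tr_V_nonneg v_pos exp_ratio_bound(1)[OF \<open>0 < t\<close> c]
    by (intro mult_left_mono) auto
  also have "\<dots> \<le> tr V / v * (t / (exp t - t - 1))"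
  proof (intro mult_left_mono divide_right_mono ct)
    show "0 \<le> exp t - t - 1" using exp_ge_add_one_self[of t] by linarith
  qed (use tr_V_nonneg v_pos in simp)
  finally show ?thesis
    using K by (simp add: s_def divide_right_mono)
qed

section \<open>Self-adjoint dilation of the centred samples\<close>

declare transpose_matrix_vector [simp del]

lemma norm_mult_vec_le: "norm (Z *v x) \<le> spectral_norm Z * norm x"
  for Z :: "real^'n^'m"
  by (rule onorm) (rule matrix_vector_mul_bounded_linear)

lemma inner_transpose_mult_vec: "(transpose Z *v x) \<bullet> y = x \<bullet> (Z *v y)"
  for Z :: "real^'n^'m"
  by (simp add: dot_lmul_matrix transpose_matrix_vector)

text \<open>Test the transpose against its own value: with \<open>?y = transpose Z *v x\<close>, the
  squared norm of \<open>?y\<close> is the inner product of \<open>x\<close> and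
  \<open>Z *v ?y\<close>.\<close>

lemma norm_transpose_mult_vec_le:
  fixes Z :: "real^'n^'m"
  assumes "0 \<le> K" and le: "\<And>y. norm (Z *v y) \<le> K * norm y"
  shows "norm (transpose Z *v x) \<le> K * norm x"
proof (cases "norm (transpose Z *v x) = 0")
  case False
  let ?y = "transpose Z *v x"
  have "norm ?y * norm ?y = x \<bullet> (Z *v ?y)"
    by (simp flip: inner_transpose_mult_vec power2_norm_eq_inner power2_eq_square)
  also have "\<dots> \<le> norm x * norm (Z *v ?y)"
    by (rule norm_cauchy_schwarz)
  also have "\<dots> \<le> norm x * (K * norm ?y)"
    by (intro mult_left_mono le) simp
  finally show ?thesis
    using False by (simp add: mult.assoc[symmetric] mult.commute[of _ K])
qed (use assms in simp)

text \<open>The block operator with zero diagonal blocks and off-diagonal blocks \<open>Z\<close>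
  and \<open>transpose Z\<close>. It is additive in \<open>Z\<close> and makes a rectangular matrix
  self-adjoint.\<close>

definition dilation :: "real^'n^'m \<Rightarrow> ((real^'m) \<times> (real^'n)) endo" where
  "dilation Z = endo_of (\<lambda>w. (Z *v snd w, transpose Z *v fst w))"

lemma app_dilation: "app (dilation Z) w = (Z *v snd w, transpose Z *v fst w)"
  unfolding dilation_def
  by (subst app_endo_of)
     (auto intro!: linearI simp: matrix_vector_right_distrib matrix_vector_mult_scaleR)

lemma transpose_add: "transpose (A + B) = transpose A + transpose B"
  by (simp add: transpose_def vec_eq_iff)

lemma dilation_add: "dilation (A + B) = dilation A + dilation B"
  by (rule endo_eqI) (simp add: app_dilation transpose_add matrix_vector_mult_add_rdistrib)

lemma dilation_scaleR: "dilation (c *\<^sub>R A) = c *\<^sub>R dilation A"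
  by (rule endo_eqI) (simp add: app_dilation transpose_scalar flip: scaleR_matrix_vector_assoc)

lemma dilation_0: "dilation 0 = 0"
  using dilation_scaleR[of 0 0] by simp

lemma dilation_sum: "dilation (\<Sum>i\<in>I. f i) = (\<Sum>i\<in>I. dilation (f i))"
  by (induction I rule: infinite_finite_induct) (simp_all add: dilation_0 dilation_add)

lemma selfadj_dilation: "selfadj (dilation Z)"
proof -
  have "x \<bullet> (transpose Z *v y) = (Z *v x) \<bullet> y" for x y
    using inner_transpose_mult_vec[of Z y x] by (simp add: inner_commute)
  then show ?thesis
    by (simp add: selfadj_def app_dilation inner_prod_def inner_transpose_mult_vec)
qed

text \<open>The square is block diagonal, with one block for each order of multiplying
  \<open>Z\<close> and its transpose.\<close>

lemma dilation_square_inner: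
  "app (dilation Z * dilation Z) w \<bullet> w = (norm (Z *v snd w))\<^sup>2 + (norm (transpose Z *v fst w))\<^sup>2"
proof -
  have "app (dilation Z * dilation Z) w \<bullet> w = app (dilation Z) w \<bullet> app (dilation Z) w"
    using selfadjD[OF selfadj_dilation, of Z "app (dilation Z) w" w] by simp
  then show ?thesis
    by (simp add: app_dilation power2_norm_eq_inner)
qed

lemma norm_dilation_le:
  assumes "0 \<le> K" and le: "\<And>y. norm (Z *v y) \<le> K * norm y"
  shows "norm (dilation Z) \<le> K"
proof (rule norm_endo_bound[OF \<open>0 \<le> K\<close>])
  fix w :: "(real^'b) \<times> (real^'a)"
  have "(norm (app (dilation Z) w))\<^sup>2 = (norm (Z *v snd w))\<^sup>2 + (norm (transpose Z *v fst w))\<^sup>2"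
    by (simp add: app_dilation norm_Pair)
  also have "\<dots> \<le> (K * norm (snd w))\<^sup>2 + (K * norm (fst w))\<^sup>2"
    by (intro add_mono power_mono le norm_transpose_mult_vec_le assms) simp_all
  also have "\<dots> = (K * norm w)\<^sup>2"
    by (simp add: norm_prod_def power_mult_distrib algebra_simps)
  finally show "norm (app (dilation Z) w) \<le> K * norm w"
    by (rule power2_le_imp_le) (simp add: assms)
qed

lemma frobenius_norm_transpose: "frobenius_norm (transpose Z) = frobenius_norm Z"
  for Z :: "real^'n^'m"
  unfolding frobenius_norm_eq by (subst sum.swap) (simp add: transpose_def)

lemma sum_Basis_mult_vec: "(\<Sum>b\<in>Basis. (norm (Z *v b))\<^sup>2) = (frobenius_norm Z)\<^sup>2"
  for Z :: "real^'n^'m"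
proof -
  have "(Basis :: (real^'n) set) = range (\<lambda>i. axis i 1)"
    by (auto simp: Basis_vec_def)
  then have "(\<Sum>b\<in>Basis. (norm (Z *v b))\<^sup>2) = (\<Sum>b\<in>range (\<lambda>i. axis i 1). (norm (Z *v b))\<^sup>2)"
    by simp
  also have "\<dots> = (\<Sum>i\<in>UNIV. (norm (column i Z))\<^sup>2)"
    by (subst sum.reindex) (simp_all add: inj_on_def axis_eq_axis matrix_vector_mult_basis)
  finally show ?thesis by (simp add: sum_norm_column)
qed

lemma tr_dilation_square: "tr (dilation Z * dilation Z) = 2 * (frobenius_norm Z)\<^sup>2"
  for Z :: "real^'n^'m"
proof -
  have "(\<Sum>b\<in>Basis. f b) = (\<Sum>u\<in>Basis. f (u, 0)) + (\<Sum>u\<in>Basis. f (0, u))"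
    for f :: "(real^'m) \<times> (real^'n) \<Rightarrow> real"
    unfolding Basis_prod_def
    by (subst sum.union_disjoint) (auto simp: sum.reindex inj_on_def)
  then show ?thesis
    unfolding tr_def dilation_square_inner
    by (simp add: sum_Basis_mult_vec frobenius_norm_transpose)
qed

lemma spectral_norm_gt_imp_dilation:
  fixes Z :: "real^'n^'m"
  assumes "0 \<le> s" "s < spectral_norm Z"
  shows "\<exists>w. norm w = 1 \<and> s < app (dilation Z) w \<bullet> w"
proof -
  have "\<not> (\<forall>y. norm (Z *v y) \<le> s * norm y)"
    using onorm_bound[of s "(*v) Z"] assms by auto
  then obtain y where y: "s * norm y < norm (Z *v y)" by (auto simp: not_le)
  define x where "x = Z *v y"
  have y0: "0 < norm y" using y by auto
  have x0: "0 < norm x" using y mult_nonneg_nonneg[OF assms(1) norm_ge_zero[of y]] unfolding x_def by linarith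
  \<comment> \<open>Pairing the normalised image of \<open>y\<close> with the normalised
    \<open>y\<close> imitates a top eigenvector of the dilation, built from a pair of singular
    vectors.\<close>
  define w where "w = (1 / sqrt 2) *\<^sub>R (x /\<^sub>R norm x, y /\<^sub>R norm y)"
  have "norm w = 1"
    using x0 y0 by (simp add: w_def norm_Pair power_divide)
  moreover have "app (dilation Z) w \<bullet> w = norm x / norm y"
  proof -
    have "app (dilation Z) w \<bullet> w = 2 * ((Z *v snd w) \<bullet> fst w)"
      by (simp add: app_dilation inner_prod_def inner_transpose_mult_vec inner_commute[of _ "fst w"])
    also have "\<dots> = (x \<bullet> x) / (norm x * norm y)"
      by (simp add: w_def matrix_vector_mult_scaleR x_def[symmetric] field_simps)
    also have "\<dots> = norm x / norm y"
      using x0 by (simp add: power2_eq_square flip: power2_norm_eq_inner)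
    finally show ?thesis .
  qed
  moreover have "s < norm x / norm y"
    using y y0 unfolding x_def by (simp only: pos_less_divide_eq)
  ultimately show ?thesis
    by (intro exI[of _ w]) simp
qed

text \<open>Centring at the mean \<open>c\<close> lowers the second moment by the squared norm of
  \<open>c\<close>. It is applied to sample matrices in Frobenius norm and to their values at a
  fixed vector.\<close>

lemma sum_norm_diff_mean_le:
  fixes u :: "'i::finite \<Rightarrow> 'a::real_inner"
  assumes "(\<Sum>i\<in>UNIV. p i) = 1"
  shows "(\<Sum>i\<in>UNIV. p i * (norm (u i - (\<Sum>i\<in>UNIV. p i *\<^sub>R u i)))\<^sup>2) \<le> (\<Sum>i\<in>UNIV. p i * (norm (u i))\<^sup>2)"
proof -
  define c where "c = (\<Sum>i\<in>UNIV. p i *\<^sub>R u i)"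
  have "(\<Sum>i\<in>UNIV. p i * (norm (u i - c))\<^sup>2)
      = (\<Sum>i\<in>UNIV. p i * (norm (u i))\<^sup>2) - 2 * ((\<Sum>i\<in>UNIV. p i *\<^sub>R u i) \<bullet> c) + (\<Sum>i\<in>UNIV. p i) * (c \<bullet> c)"
  proof -
    have "p i * (norm (u i - c))\<^sup>2 = p i * (norm (u i))\<^sup>2 - 2 * ((p i *\<^sub>R u i) \<bullet> c) + p i * (c \<bullet> c)" for i
      unfolding power2_norm_eq_inner by (simp add: inner_diff inner_commute[of c "u i"] algebra_simps)
    then show ?thesis
      by (simp only: sum.distrib sum_subtractf inner_sum_left sum_distrib_right flip: sum_distrib_left)
  qed
  also have "\<dots> = (\<Sum>i\<in>UNIV. p i * (norm (u i))\<^sup>2) - c \<bullet> c"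
    by (simp add: assms flip: c_def)
  also have "\<dots> \<le> (\<Sum>i\<in>UNIV. p i * (norm (u i))\<^sup>2)" by simp
  finally show ?thesis by (simp add: c_def)
qed

section \<open>Moments and norm bounds for one sample\<close>

lemma outer_product_mult_vec: "outer_product a b *v y = (b \<bullet> y) *\<^sub>R a"
  by (simp add: vec_eq_iff outer_product_def matrix_vector_mult_def inner_vec_def
      sum_distrib_right sum_distrib_left ac_simps)

lemma frobenius_norm_outer_product: "(frobenius_norm (outer_product a b))\<^sup>2 = (norm a)\<^sup>2 * (norm b)\<^sup>2"
proof -
  have n: "(norm a)\<^sup>2 = (\<Sum>i\<in>UNIV. (a $ i)\<^sup>2)" for a :: "real^'n"
    by (simp add: norm_vec_def L2_set_def sum_nonneg)
  show ?thesis
    unfolding frobenius_norm_eq n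
    by (simp add: outer_product_def power_mult_distrib sum_product sum_nonneg)
qed

lemma matrix_mult_transpose_eq_sum: "A ** transpose B = (\<Sum>i\<in>UNIV. outer_product (column i A) (column i B))"
  by (simp add: vec_eq_iff matrix_matrix_mult_def transpose_def outer_product_def column_def)

lemma sampling_prob_commute: "sampling_prob B A i = sampling_prob A B i"
  by (simp add: sampling_prob_def)

lemma transpose_sample_matrix: "transpose (sample_matrix A B i) = sample_matrix B A i"
  by (simp add: vec_eq_iff transpose_def sample_matrix_def outer_product_def sampling_prob_commute[of A])

lemma sampling_prob_ge:
  assumes "A \<noteq> 0"
  shows "(norm (column i A))\<^sup>2 \<le> sampling_prob A B i * (2 * (frobenius_norm A)\<^sup>2)"
  using assms by (simp add: sampling_prob_def field_simps)

text \<open>The probability is the arithmetic mean of the squares of \<open>?x\<close> and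
  \<open>?y\<close>, hence at least their product. This bounds all samples uniformly.\<close>

lemma sampling_prob_AM_GM:
  assumes "A \<noteq> 0" "B \<noteq> 0"
  shows "norm (column i A) * norm (column i B) \<le> sampling_prob A B i * (frobenius_norm A * frobenius_norm B)"
proof -
  let ?x = "norm (column i A) / norm A" and ?y = "norm (column i B) / norm B"
  have "0 \<le> (?x - ?y)\<^sup>2" by simp
  then have "?x * ?y \<le> sampling_prob A B i"
    unfolding power2_diff by (simp add: sampling_prob_def power_divide ac_simps)
  then have "?x * ?y * (norm A * norm B) \<le> sampling_prob A B i * (norm A * norm B)"
    by (rule mult_right_mono) simp
  then show ?thesis using assms by simp
qed

lemma sum_sample_matrix:
  assumes "A \<noteq> 0" "B \<noteq> 0"
  shows "(\<Sum>i\<in>UNIV. sampling_prob A B i *\<^sub>R sample_matrix A B i) = A ** transpose B"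
  unfolding matrix_mult_transpose_eq_sum
proof (intro sum.cong refl)
  fix i
  show "sampling_prob A B i *\<^sub>R sample_matrix A B i = outer_product (column i A) (column i B)"
  proof (cases "sampling_prob A B i = 0")
    \<comment> \<open>Probability zero forces the column of \<open>A\<close> to vanish, so the
      omitted summand of the product is zero as well.\<close>
    case True
    then have "column i A = 0"
      using sampling_prob_ge[OF assms(1), of i B] by simp
    then show ?thesis by (simp add: True outer_product_def vec_eq_iff)
  qed (simp add: sample_matrix_def)
qed

text \<open>Shared by both second moments: one factor of the probability cancels, and the half of
  the mixture coming from \<open>A\<close> bounds the other, at the cost of the factor 2.
  \<open>K\<close> stands for what the column of \<open>B\<close> contributes.\<close>

lemma prob_sample_matrix_square_le:
  assumes "A \<noteq> 0" "0 \<le> K"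
    and q: "q = (norm (column i A))\<^sup>2 * K * (1 / sampling_prob A B i)\<^sup>2"
  shows "sampling_prob A B i * q \<le> 2 * (frobenius_norm A)\<^sup>2 * K"
proof (cases "sampling_prob A B i = 0")
  case False
  let ?p = "sampling_prob A B i"
  have p: "0 < ?p" using False sampling_prob_nonneg[of A B i] by simp
  have "?p * q = (norm (column i A))\<^sup>2 * K / ?p"
    using p by (simp add: q power2_eq_square)
  also have "\<dots> \<le> ?p * (2 * (frobenius_norm A)\<^sup>2) * K / ?p"
    using p assms(2) sampling_prob_ge[OF assms(1), of i B] by (intro divide_right_mono mult_right_mono) auto
  finally show ?thesis using p by simp
qed (use assms in simp)

text \<open>After the sampling weights cancel, the squares
  \<open>(column i B \<bullet> y)\<^sup>2\<close> add up to the squared norm of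
  \<open>transpose B *v y\<close>.\<close>

lemma sum_sample_matrix_mult_vec_le:
  assumes "A \<noteq> 0"
  shows "(\<Sum>i\<in>UNIV. sampling_prob A B i * (norm (sample_matrix A B i *v y))\<^sup>2)
    \<le> 2 * (frobenius_norm A)\<^sup>2 * (spectral_norm B)\<^sup>2 * (norm y)\<^sup>2"
proof -
  have "(transpose B *v y) $ i = column i B \<bullet> y" for i
    by (simp add: matrix_vector_mult_def transpose_def inner_vec_def column_def)
  then have norm_sq: "(norm (transpose B *v y))\<^sup>2 = (\<Sum>i\<in>UNIV. (column i B \<bullet> y)\<^sup>2)"
    by (simp add: norm_vec_def L2_set_def sum_nonneg)
  have "sampling_prob A B i * (norm (sample_matrix A B i *v y))\<^sup>2
      \<le> 2 * (frobenius_norm A)\<^sup>2 * (column i B \<bullet> y)\<^sup>2" for i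
    by (rule prob_sample_matrix_square_le[OF assms])
       (simp_all add: sample_matrix_def outer_product_mult_vec power_mult_distrib power_divide
         flip: scaleR_matrix_vector_assoc)
  then have "(\<Sum>i\<in>UNIV. sampling_prob A B i * (norm (sample_matrix A B i *v y))\<^sup>2)
      \<le> (\<Sum>i\<in>UNIV. 2 * (frobenius_norm A)\<^sup>2 * (column i B \<bullet> y)\<^sup>2)"
    by (intro sum_mono)
  also have "\<dots> = 2 * (frobenius_norm A)\<^sup>2 * (norm (transpose B *v y))\<^sup>2"
    by (simp add: norm_sq sum_distrib_left)
  also have "\<dots> \<le> 2 * (frobenius_norm A)\<^sup>2 * (spectral_norm B * norm y)\<^sup>2"
    by (intro mult_left_mono power_mono norm_transpose_mult_vec_le norm_mult_vec_le onorm_pos_le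
        matrix_vector_mul_bounded_linear) simp_all
  finally show ?thesis by (simp add: power_mult_distrib ac_simps)
qed

lemma sum_frobenius_sample_matrix_le:
  assumes "A \<noteq> 0"
  shows "(\<Sum>i\<in>UNIV. sampling_prob A B i * (frobenius_norm (sample_matrix A B i))\<^sup>2)
    \<le> 2 * (frobenius_norm A)\<^sup>2 * (frobenius_norm B)\<^sup>2"
proof -
  have "sampling_prob A B i * (frobenius_norm (sample_matrix A B i))\<^sup>2
      \<le> 2 * (frobenius_norm A)\<^sup>2 * (norm (column i B))\<^sup>2" for i
    by (rule prob_sample_matrix_square_le[OF assms])
       (simp_all add: sample_matrix_def frobenius_norm_outer_product power_mult_distrib power_divide)
  then have "(\<Sum>i\<in>UNIV. sampling_prob A B i * (frobenius_norm (sample_matrix A B i))\<^sup>2)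
      \<le> (\<Sum>i\<in>UNIV. 2 * (frobenius_norm A)\<^sup>2 * (norm (column i B))\<^sup>2)"
    by (intro sum_mono)
  also have "\<dots> = 2 * (frobenius_norm A)\<^sup>2 * (frobenius_norm B)\<^sup>2"
    by (simp add: sum_norm_column flip: sum_distrib_left)
  finally show ?thesis .
qed

lemma norm_sample_matrix_mult_vec_le:
  assumes "A \<noteq> 0" "B \<noteq> 0"
  shows "norm (sample_matrix A B i *v y) \<le> frobenius_norm A * frobenius_norm B * norm y"
proof (cases "sampling_prob A B i = 0")
  case True
  then show ?thesis by (simp add: sample_matrix_def)
next
  case False
  let ?p = "sampling_prob A B i"
  have p: "0 < ?p" using False sampling_prob_nonneg[of A B i] by simp
  have "norm (sample_matrix A B i *v y) = \<bar>column i B \<bullet> y\<bar> * norm (column i A) / ?p"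
    using p by (simp add: sample_matrix_def outer_product_mult_vec flip: scaleR_matrix_vector_assoc)
  also have "\<dots> \<le> norm (column i B) * norm y * norm (column i A) / ?p"
    using p by (intro divide_right_mono mult_right_mono Cauchy_Schwarz_ineq2) auto
  also have "\<dots> = norm (column i A) * norm (column i B) * norm y / ?p"
    by simp
  also have "\<dots> \<le> ?p * (frobenius_norm A * frobenius_norm B) * norm y / ?p"
    using p by (intro divide_right_mono mult_right_mono sampling_prob_AM_GM assms) auto
  finally show ?thesis using p by simp
qed

lemma spectral_norm_pos:
  fixes A :: "real^'n^'m"
  assumes "A \<noteq> 0"
  shows "0 < spectral_norm A"
proof -
  have "\<exists>x. A *v x \<noteq> 0"
    using assms matrix_eq[of A 0] by auto
  then show ?thesis
    by (simp add: onorm_pos_lt[OF matrix_vector_mul_bounded_linear])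
qed

definition centred_sample :: "real^'n^'d1 \<Rightarrow> real^'n^'d2 \<Rightarrow> 'n \<Rightarrow> real^'d2^'d1" where
  "centred_sample A B i = sample_matrix A B i - A ** transpose B"

text \<open>Each entry of the maximum bounds one diagonal block of the variance of the dilated
  centred sample. The factor 2 is the one in \<open>sampling_prob_ge\<close>.\<close>

definition sampling_variance :: "real^'n^'d1 \<Rightarrow> real^'n^'d2 \<Rightarrow> real" where
  "sampling_variance A B = 2 * max ((frobenius_norm A)\<^sup>2 * (spectral_norm B)\<^sup>2)
     ((frobenius_norm B)\<^sup>2 * (spectral_norm A)\<^sup>2)"

lemma sum_centred_sample_mult_vec_le:
  fixes A :: "real^'n^'d1" and B :: "real^'n^'d2"
  assumes "A \<noteq> 0" "B \<noteq> 0"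
  shows "(\<Sum>i\<in>UNIV. sampling_prob A B i * (norm (centred_sample A B i *v y))\<^sup>2)
    \<le> 2 * ((frobenius_norm A)\<^sup>2 * (spectral_norm B)\<^sup>2) * (norm y)\<^sup>2"
proof -
  have lin: "linear (\<lambda>Z :: real^'d2^'d1. Z *v y)"
    by (rule linearI) (simp_all add: matrix_vector_mult_add_rdistrib flip: scaleR_matrix_vector_assoc)
  have "(A ** transpose B) *v y = (\<Sum>i\<in>UNIV. sampling_prob A B i *\<^sub>R (sample_matrix A B i *v y))"
    unfolding sum_sample_matrix[OF assms, symmetric]
    by (simp add: linear_sum[OF lin] flip: scaleR_matrix_vector_assoc)
  with sum_norm_diff_mean_le[OF sum_sampling_prob[OF assms], of "\<lambda>i. sample_matrix A B i *v y"]
    sum_sample_matrix_mult_vec_le[OF assms(1), of B y]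
  show ?thesis by (simp add: centred_sample_def matrix_vector_mult_diff_rdistrib mult.assoc)
qed

text \<open>The step bound adds the uniform bound on a sample to the bound
  \<open>spectral_norm A * spectral_norm B\<close> for its mean.\<close>

lemma operator_walk_sample:
  fixes A :: "real^'n^'d1" and B :: "real^'n^'d2"
  assumes "A \<noteq> 0" "B \<noteq> 0"
  shows "operator_walk (sampling_prob A B) (\<lambda>i. dilation (centred_sample A B i))
    (frobenius_norm A * frobenius_norm B + spectral_norm A * spectral_norm B)
    (sampling_variance A B)"
proof
  note pos = spectral_norm_pos[OF assms(1)] spectral_norm_pos[OF assms(2)]
  show "0 \<le> sampling_prob A B i" for i by (rule sampling_prob_nonneg)
  show "(\<Sum>i\<in>UNIV. sampling_prob A B i) = 1" by (rule sum_sampling_prob[OF assms])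
  show "selfadj (dilation (centred_sample A B i))" for i by (rule selfadj_dilation)
  have "(\<Sum>i\<in>UNIV. sampling_prob A B i *\<^sub>R centred_sample A B i) = 0"
    by (simp add: centred_sample_def scaleR_diff_right sum_subtractf sum_sample_matrix[OF assms] sum_sampling_prob[OF assms]
        flip: scaleR_sum_left)
  then show "(\<Sum>i\<in>UNIV. sampling_prob A B i *\<^sub>R dilation (centred_sample A B i)) = 0"
    by (simp add: dilation_0 flip: dilation_scaleR dilation_sum)
  show "norm (dilation (centred_sample A B i))
      \<le> frobenius_norm A * frobenius_norm B + spectral_norm A * spectral_norm B" for i
  proof (rule norm_dilation_le)
    fix y
    have "norm (transpose B *v y) \<le> spectral_norm B * norm y"
      using pos by (intro norm_transpose_mult_vec_le norm_mult_vec_le) simp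
    then have "norm (A *v (transpose B *v y)) \<le> spectral_norm A * (spectral_norm B * norm y)"
      using pos by (meson norm_mult_vec_le mult_left_mono order_trans less_imp_le)
    then have "norm (sample_matrix A B i *v y) + norm ((A ** transpose B) *v y)
        \<le> frobenius_norm A * frobenius_norm B * norm y + spectral_norm A * (spectral_norm B * norm y)"
      by (intro add_mono norm_sample_matrix_mult_vec_le assms) (simp add: matrix_vector_mul_assoc)
    with norm_triangle_ineq4[of "sample_matrix A B i *v y" "(A ** transpose B) *v y"]
    show "norm (centred_sample A B i *v y)
        \<le> (frobenius_norm A * frobenius_norm B + spectral_norm A * spectral_norm B) * norm y"
      unfolding centred_sample_def matrix_vector_mult_diff_rdistrib distrib_right mult.assoc
      by linarith
  qed (use pos in simp)
  show "0 < sampling_variance A B"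
    using pos assms by (simp add: sampling_variance_def less_max_iff_disj)
  show "psd (sampling_variance A B *\<^sub>R 1 - (\<Sum>i\<in>UNIV. sampling_prob A B i *\<^sub>R
      (dilation (centred_sample A B i) * dilation (centred_sample A B i))))"
    unfolding psd_def
  proof
    fix w :: "(real^'d1) \<times> (real^'d2)"
    \<comment> \<open>Transposition exchanges the roles of \<open>A\<close> and \<open>B\<close>, so
      one variance estimate serves both diagonal blocks.\<close>
    have t: "transpose (centred_sample A B i) = centred_sample B A i" for i
    proof -
      have "transpose (centred_sample A B i) = transpose (sample_matrix A B i) - transpose (A ** transpose B)"
        by (simp add: centred_sample_def transpose_def vec_eq_iff)
      then show ?thesis by (simp add: centred_sample_def transpose_sample_matrix matrix_transpose_mul)
    qed
    have "(\<Sum>i\<in>UNIV. sampling_prob A B i *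
        (app (dilation (centred_sample A B i) * dilation (centred_sample A B i)) w \<bullet> w))
      = (\<Sum>i\<in>UNIV. sampling_prob A B i * (norm (centred_sample A B i *v snd w))\<^sup>2)
        + (\<Sum>i\<in>UNIV. sampling_prob B A i * (norm (centred_sample B A i *v fst w))\<^sup>2)"
      unfolding dilation_square_inner t
      by (simp add: distrib_left sum.distrib sampling_prob_commute[of B])
    also have "\<dots> \<le> 2 * ((frobenius_norm A)\<^sup>2 * (spectral_norm B)\<^sup>2) * (norm (snd w))\<^sup>2
        + 2 * ((frobenius_norm B)\<^sup>2 * (spectral_norm A)\<^sup>2) * (norm (fst w))\<^sup>2"
      by (intro add_mono sum_centred_sample_mult_vec_le assms)
    also have "\<dots> \<le> sampling_variance A B * (norm (snd w))\<^sup>2 + sampling_variance A B * (norm (fst w))\<^sup>2"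
      by (intro add_mono mult_right_mono) (simp_all add: sampling_variance_def)
    also have "\<dots> = sampling_variance A B * (w \<bullet> w)"
      by (cases w) (simp add: power2_norm_eq_inner algebra_simps)
    finally show "0 \<le> app (sampling_variance A B *\<^sub>R 1 - (\<Sum>i\<in>UNIV. sampling_prob A B i *\<^sub>R
        (dilation (centred_sample A B i) * dilation (centred_sample A B i)))) w \<bullet> w"
      by (simp add: inner_diff_left inner_sum_left del: app_mult)
  qed
qed

text \<open>The constant 4 combines the two blocks of the dilation with the factor 2 from the
  sampling probabilities; centring only decreases the second moment.\<close>

lemma tr_variance_sample_le:
  assumes "A \<noteq> 0" "B \<noteq> 0"
  shows "tr (\<Sum>i\<in>UNIV. sampling_prob A B i *\<^sub>R (dilation (centred_sample A B i) * dilation (centred_sample A B i)))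
    \<le> 4 * (frobenius_norm A)\<^sup>2 * (frobenius_norm B)\<^sup>2"
proof -
  have "tr (\<Sum>i\<in>UNIV. sampling_prob A B i *\<^sub>R (dilation (centred_sample A B i) * dilation (centred_sample A B i)))
      = 2 * (\<Sum>i\<in>UNIV. sampling_prob A B i * (frobenius_norm (centred_sample A B i))\<^sup>2)"
    by (simp add: tr_sum tr_scaleR tr_dilation_square sum_distrib_left ac_simps)
  also have "\<dots> \<le> 2 * (\<Sum>i\<in>UNIV. sampling_prob A B i * (frobenius_norm (sample_matrix A B i))\<^sup>2)"
    using sum_norm_diff_mean_le[OF sum_sampling_prob[OF assms], of "sample_matrix A B"]
    by (simp add: sum_sample_matrix[OF assms] centred_sample_def)
  also have "\<dots> \<le> 2 * (2 * (frobenius_norm A)\<^sup>2 * (frobenius_norm B)\<^sup>2)"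
    by (intro mult_left_mono sum_frobenius_sample_matrix_le assms) simp
  finally show ?thesis by simp
qed

section \<open>The law of the sum of independent samples\<close>

text \<open>Fubini: integrating out one coordinate replaces \<open>g\<close> by its one-step average
  \<open>g'\<close>, as in the recursion of \<open>walk_expectation\<close>. Hence the induction is
  over arbitrary \<open>g\<close> and \<open>z\<close>.\<close>

lemma nn_integral_PiM_walk:
  fixes q :: "'i::finite pmf" and f :: "'i \<Rightarrow> 'b::euclidean_space" and g :: "'b \<Rightarrow> real"
  defines "N \<equiv> distr (measure_pmf q) borel f"
  assumes "finite J" and "g \<in> borel_measurable borel" and "\<And>z. 0 \<le> g z"
  shows "(\<integral>\<^sup>+x. ennreal (g (z + (\<Sum>j\<in>J. x j - c))) \<partial>PiM J (\<lambda>_. N))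
    = ennreal (walk_expectation (pmf q) (\<lambda>i. f i - c) (card J) g z)"
proof -
  interpret N: prob_space N
    unfolding N_def by (intro prob_space.prob_space_distr measure_pmf.prob_space_axioms) simp
  interpret product_sigma_finite "\<lambda>_. N"
    by standard
  have [measurable_cong]: "sets N = sets borel"
    by (simp add: N_def)
  show ?thesis
    using assms(2-4)
  proof (induction J arbitrary: g z rule: finite_induct)
    case empty
    then show ?case
      by (simp add: PiM_empty nn_integral_count_space_finite)
  next
    case (insert j J)
    note [measurable] = \<open>g \<in> borel_measurable borel\<close>
    define g' where "g' z = (\<Sum>i\<in>UNIV. pmf q i * g (z + (f i - c)))" for z
    have g': "g' \<in> borel_measurable borel" "\<And>z. 0 \<le> g' z"
      unfolding g'_def[abs_def] using insert.prems(2) by (auto intro!: sum_nonneg)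
    have "(\<integral>\<^sup>+x. ennreal (g (z + (\<Sum>k\<in>insert j J. x k - c))) \<partial>PiM (insert j J) (\<lambda>_. N))
        = (\<integral>\<^sup>+x. (\<integral>\<^sup>+y. ennreal (g (z + (\<Sum>k\<in>insert j J. (x(j := y)) k - c))) \<partial>N) \<partial>PiM J (\<lambda>_. N))"
      using insert.hyps by (intro product_nn_integral_insert) measurable
    also have "\<dots> = (\<integral>\<^sup>+x. ennreal (g' (z + (\<Sum>k\<in>J. x k - c))) \<partial>PiM J (\<lambda>_. N))"
    proof (intro nn_integral_cong)
      fix x
      define S where "S = z + (\<Sum>k\<in>J. x k - c)"
      have "(\<Sum>k\<in>J. (x(j := y)) k - c) = (\<Sum>k\<in>J. x k - c)" for y
        using insert.hyps by (intro sum.cong) auto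
      then have "z + (\<Sum>k\<in>insert j J. (x(j := y)) k - c) = S + (y - c)" for y
        using insert.hyps by (simp add: S_def algebra_simps)
      then have "(\<integral>\<^sup>+y. ennreal (g (z + (\<Sum>k\<in>insert j J. (x(j := y)) k - c))) \<partial>N)
          = (\<integral>\<^sup>+y. ennreal (g (S + (y - c))) \<partial>N)"
        by simp
      also have "\<dots> = (\<integral>\<^sup>+i. ennreal (g (S + (f i - c))) \<partial>measure_pmf q)"
        unfolding N_def by (subst nn_integral_distr) simp_all
      also have "\<dots> = (\<Sum>i\<in>UNIV. ennreal (g (S + (f i - c))) * pmf q i)"
        by (rule nn_integral_measure_pmf_support) simp_all
      also have "\<dots> = ennreal (g' S)"
        using insert.prems(2)
        by (simp add: g'_def ennreal_mult'[symmetric] sum_ennreal mult.commute)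
      finally show "(\<integral>\<^sup>+y. ennreal (g (z + (\<Sum>k\<in>insert j J. (x(j := y)) k - c))) \<partial>N)
          = ennreal (g' (z + (\<Sum>k\<in>J. x k - c)))"
        by (simp only: S_def)
    qed
    also have "\<dots> = ennreal (walk_expectation (pmf q) (\<lambda>i. f i - c) (card J) g' z)"
      by (rule insert.IH[OF g'])
    finally show ?case
      using insert.hyps by (simp add: g'_def[abs_def])
  qed
qed

lemma (in prob_space) prob_sum_iid_eq_walk_expectation:
  fixes q :: "'i::finite pmf" and f :: "'i \<Rightarrow> 'b::euclidean_space"
  assumes ind: "indep_vars (\<lambda>_. borel) X J" and J: "finite J" "J \<noteq> {}"
    and law: "\<And>j. j \<in> J \<Longrightarrow> distr M borel (X j) = distr (measure_pmf q) borel f"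
    and U: "U \<in> sets borel"
  shows "prob {\<omega> \<in> space M. (\<Sum>j\<in>J. X j \<omega> - c) \<in> U}
    = walk_expectation (pmf q) (\<lambda>i. f i - c) (card J) (indicator U) 0"
proof -
  let ?N = "distr (measure_pmf q) borel f"
  have X [measurable]: "j \<in> J \<Longrightarrow> random_variable borel (X j)" for j
    using ind by (simp add: indep_vars_def)
  note [measurable] = U
  let ?E = "{x \<in> space (PiM J (\<lambda>_. borel)). (\<Sum>j\<in>J. x j - c) \<in> U}"
  have E: "?E \<in> sets (PiM J (\<lambda>_. borel))"
    by measurable
  have "distr M (PiM J (\<lambda>_. borel)) (\<lambda>\<omega>. \<lambda>j\<in>J. X j \<omega>) = PiM J (\<lambda>j. distr M borel (X j))"
    using ind indep_vars_iff_distr_eq_PiM'[OF J(2), where M' = "\<lambda>_. borel" and X = X] X by simp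
  also have "\<dots> = PiM J (\<lambda>_. ?N)"
    using law by (intro PiM_cong) auto
  finally have D: "distr M (PiM J (\<lambda>_. borel)) (\<lambda>\<omega>. \<lambda>j\<in>J. X j \<omega>) = PiM J (\<lambda>_. ?N)" .
  have sN: "sets (PiM J (\<lambda>_. ?N)) = sets (PiM J (\<lambda>_. borel))"
    by (intro sets_PiM_cong) auto
  have "emeasure M {\<omega> \<in> space M. (\<Sum>j\<in>J. X j \<omega> - c) \<in> U}
      = emeasure M ((\<lambda>\<omega>. \<lambda>j\<in>J. X j \<omega>) -` ?E \<inter> space M)"
    by (intro arg_cong[where f = "emeasure M"]) (auto simp: space_PiM)
  also have "\<dots> = emeasure (distr M (PiM J (\<lambda>_. borel)) (\<lambda>\<omega>. \<lambda>j\<in>J. X j \<omega>)) ?E"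
    using E by (subst emeasure_distr) auto
  also have "\<dots> = (\<integral>\<^sup>+x. indicator ?E x \<partial>PiM J (\<lambda>_. ?N))"
    using E by (simp add: D sN)
  also have "\<dots> = (\<integral>\<^sup>+x. ennreal (indicator U (0 + (\<Sum>j\<in>J. x j - c))) \<partial>PiM J (\<lambda>_. ?N))"
    by (intro nn_integral_cong) (auto simp: space_PiM split: split_indicator)
  also have "\<dots> = ennreal (walk_expectation (pmf q) (\<lambda>i. f i - c) (card J) (indicator U) 0)"
    by (rule nn_integral_PiM_walk) (simp_all add: J U)
  finally have *: "emeasure M {\<omega> \<in> space M. (\<Sum>j\<in>J. X j \<omega> - c) \<in> U}
    = ennreal (walk_expectation (pmf q) (\<lambda>i. f i - c) (card J) (indicator U) 0)" .
  \<comment> \<open>The walk expectation is shown to be nonnegative, so that \<open>ennreal\<close>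
    can be stripped from the equation above.\<close>
  have "walk_expectation (pmf q) (\<lambda>i. f i - c) (card J) (\<lambda>_. 0) 0
      \<le> walk_expectation (pmf q) (\<lambda>i. f i - c) (card J) (indicator U) 0"
    by (rule walk_expectation_mono[where Q = "\<lambda>_. True"]) auto
  moreover have "walk_expectation (pmf q) (\<lambda>i. f i - c) k (\<lambda>_. 0) 0 = 0" for k
    by (induction k) simp_all
  ultimately show ?thesis
    using * by (simp add: measure_def)
qed

text \<open>Makes the tail event measurable: it is the union over \<open>y\<close> of the open
  conditions that \<open>y\<close> witnesses a norm above \<open>s\<close>.\<close>

lemma open_spectral_norm_gt:
  assumes "0 \<le> s"
  shows "open {Z :: real^'n^'m. s < spectral_norm Z}"
proof -
  have "{Z :: real^'n^'m. s < spectral_norm Z} = (\<Union>y. {Z. s * norm y < norm (Z *v y)})"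
  proof (intro equalityI subsetI)
    fix Z :: "real^'n^'m" assume "Z \<in> {Z. s < spectral_norm Z}"
    then have "\<not> (\<forall>y. norm (Z *v y) \<le> s * norm y)"
      using onorm_bound[of s "(*v) Z"] assms by auto
    then show "Z \<in> (\<Union>y. {Z. s * norm y < norm (Z *v y)})" by (auto simp: not_le)
  next
    fix Z :: "real^'n^'m" assume "Z \<in> (\<Union>y. {Z. s * norm y < norm (Z *v y)})"
    then obtain y where "s * norm y < norm (Z *v y)" by blast
    then have "s * norm y < spectral_norm Z * norm y"
      using norm_mult_vec_le[of Z y] by linarith
    then show "Z \<in> {Z. s < spectral_norm Z}"
      using mult_less_cancel_right_pos[of "norm y" s "spectral_norm Z"] by (cases "norm y = 0") auto
  qed
  moreover have "open {Z :: real^'n^'m. s * norm y < norm (Z *v y)}" for y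
  proof (intro open_Collect_less continuous_intros)
    have "linear (\<lambda>Z :: real^'n^'m. Z *v y)"
      by (rule linearI) (simp_all add: matrix_vector_mult_add_rdistrib flip: scaleR_matrix_vector_assoc)
    then show "continuous_on UNIV (\<lambda>Z :: real^'n^'m. Z *v y)"
      by (rule linear_continuous_on[OF linear_conv_bounded_linear[THEN iffD1]])
  qed
  ultimately show ?thesis by auto
qed

lemma sum_centred_sample_tail:
  fixes A :: "real^'n^'d1" and B :: "real^'n^'d2" and X :: "nat \<Rightarrow> 'w \<Rightarrow> real^'d2^'d1"
  assumes AB: "A \<noteq> 0" "B \<noteq> 0" and "0 < m" and M: "prob_space M"
    and ind: "prob_space.indep_vars M (\<lambda>_. borel) X {1..m}"
    and law: "\<And>j. j \<in> {1..m} \<Longrightarrow> distr M borel (X j) = sample_law A B"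
    and t: "0 < t"
  defines "L \<equiv> frobenius_norm A * frobenius_norm B + spectral_norm A * spectral_norm B"
  shows "measure M {\<omega> \<in> space M.
      sqrt (2 * real m * sampling_variance A B * t) + L * t
        < spectral_norm (\<Sum>j=1..m. X j \<omega> - A ** transpose B)}
    \<le> 4 * (frobenius_norm A)\<^sup>2 * (frobenius_norm B)\<^sup>2 / sampling_variance A B * (t / (exp t - t - 1))"
proof -
  interpret prob_space M by (rule M)
  interpret W: operator_walk "sampling_prob A B" "\<lambda>i. dilation (centred_sample A B i)" L "sampling_variance A B"
    unfolding L_def by (rule operator_walk_sample[OF AB])
  define s where "s = sqrt (2 * real m * sampling_variance A B * t) + L * t"
  have "0 \<le> L" using W.Y_norm[of undefined] norm_ge_zero order_trans by blast
  then have s: "0 \<le> s" using t W.v_pos by (simp add: s_def)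
  define U where "U = {Z :: real^'d2^'d1. s < spectral_norm Z}"
  have "U \<in> sets borel" unfolding U_def by (rule borel_open[OF open_spectral_norm_gt[OF s]])
  moreover have pmf: "pmf (sampling_pmf A B) = sampling_prob A B"
    using pmf_sampling_pmf[OF AB] by blast
  ultimately have "measure M {\<omega> \<in> space M. (\<Sum>j=1..m. X j \<omega> - A ** transpose B) \<in> U}
      = walk_expectation (sampling_prob A B) (centred_sample A B) m (indicator U) 0"
    using prob_sum_iid_eq_walk_expectation[OF ind, where q = "sampling_pmf A B" and f = "sample_matrix A B"
        and U = U and c = "A ** transpose B"] law \<open>0 < m\<close>
    by (simp add: sample_law_def centred_sample_def[abs_def])
  \<comment> \<open>The walk still runs over matrices here; only the event is enlarged to one about
    dilations, and the walk itself is transported next.\<close>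
  also have "\<dots> \<le> walk_expectation (sampling_prob A B) (centred_sample A B) m
      (\<lambda>Z. of_bool (\<exists>w. norm w = 1 \<and> s < app (dilation Z) w \<bullet> w)) 0"
    by (rule walk_expectation_mono[where Q = "\<lambda>_. True"])
       (use spectral_norm_gt_imp_dilation[OF s] in \<open>auto simp: sampling_prob_nonneg U_def indicator_def\<close>)
  also have "\<dots> = walk_expectation (sampling_prob A B) (\<lambda>i. dilation (centred_sample A B i)) m
      (\<lambda>S. of_bool (\<exists>w. norm w = 1 \<and> s < app S w \<bullet> w)) (dilation 0)"
    by (rule walk_expectation_map[symmetric]) (rule dilation_add)
  also have "\<dots> \<le> tr W.V / sampling_variance A B * (t / (exp t - t - 1))"
    unfolding dilation_0 s_def by (rule W.walk_tail_bound[OF \<open>0 < m\<close> t])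
  also have "\<dots> \<le> 4 * (frobenius_norm A)\<^sup>2 * (frobenius_norm B)\<^sup>2 / sampling_variance A B * (t / (exp t - t - 1))"
  proof (intro mult_right_mono divide_right_mono)
    show "tr W.V \<le> 4 * (frobenius_norm A)\<^sup>2 * (frobenius_norm B)\<^sup>2"
      unfolding W.V_def by (rule tr_variance_sample_le[OF AB])
    have "0 \<le> exp t - t - 1" using exp_ge_add_one_self[of t] by linarith
    then show "0 \<le> t / (exp t - t - 1)" using t by simp
  qed (use W.v_pos in simp)
  finally show ?thesis by (simp add: U_def s_def)
qed

theorem theorem1:
  fixes A :: "real^'n^'d1" and B :: "real^'n^'d2"
    and M :: "'w measure" and X :: "nat \<Rightarrow> 'w \<Rightarrow> real^'d2^'d1"
    and m :: nat and t :: real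
  assumes "A \<noteq> 0" and "B \<noteq> 0"
    and "m > 0"
    and "prob_space M"
    and "prob_space.indep_vars M (\<lambda>_. borel) X {1..m}"
    and "\<And>j. j \<in> {1..m} \<Longrightarrow> distr M borel (X j) = sample_law A B"
    and "t > 0"
  shows "measure M {\<omega> \<in> space M.
            spectral_norm (product_estimator m X \<omega> - A ** transpose B)
              / (spectral_norm A * spectral_norm B)
            > sqrt (4 * max (stable_rank A) (stable_rank B) * t / real m)
              + (sqrt (stable_rank A * stable_rank B) + 1) * t / real m}
         \<le> 4 * min (stable_rank A) (stable_rank B) * (t / (exp t - t - 1))"
proof -
  define a b where "a = spectral_norm A" and "b = spectral_norm B"
  define F G where "F = frobenius_norm A" and "G = frobenius_norm B"
  define v where "v = sampling_variance A B"
  have pos: "0 < a" "0 < b" "0 < F" "0 < G"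
    using assms(1,2) by (simp_all add: a_def b_def F_def G_def spectral_norm_pos)
  have sr: "stable_rank A = (F / a)\<^sup>2" "stable_rank B = (G / b)\<^sup>2"
    by (simp_all add: stable_rank_def a_def b_def F_def G_def power_divide)
  \<comment> \<open>The maximum of the stable ranks comes from the two blocks of the
    variance.\<close>
  have v: "v = 2 * (a * b)\<^sup>2 * max (stable_rank A) (stable_rank B)"
  proof -
    have "max ((a * b)\<^sup>2 * stable_rank A) ((a * b)\<^sup>2 * stable_rank B)
        = (a * b)\<^sup>2 * max (stable_rank A) (stable_rank B)"
      using pos by (simp add: max_def)
    moreover have "(a * b)\<^sup>2 * stable_rank A = F\<^sup>2 * b\<^sup>2" "(a * b)\<^sup>2 * stable_rank B = G\<^sup>2 * a\<^sup>2"
      using pos by (simp_all add: sr power_mult_distrib power_divide)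
    ultimately show ?thesis
      by (simp add: v_def sampling_variance_def a_def b_def F_def G_def)
  qed
  define \<tau> where "\<tau> = sqrt (4 * max (stable_rank A) (stable_rank B) * t / real m)
      + (sqrt (stable_rank A * stable_rank B) + 1) * t / real m"
  have "real m * (a * b) * sqrt (4 * max (stable_rank A) (stable_rank B) * t / real m)
      = sqrt ((real m * (a * b))\<^sup>2 * (4 * max (stable_rank A) (stable_rank B) * t / real m))"
    unfolding real_sqrt_mult[of "(real m * (a * b))\<^sup>2"] using pos by simp
  also have "(real m * (a * b))\<^sup>2 * (4 * max (stable_rank A) (stable_rank B) * t / real m) = 2 * real m * v * t"
    using assms(3) by (simp add: v power2_eq_square)
  finally have "real m * (a * b) * sqrt (4 * max (stable_rank A) (stable_rank B) * t / real m)
      = sqrt (2 * real m * v * t)" .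
  moreover have sqrt_sr: "sqrt (stable_rank A * stable_rank B) = F / a * (G / b)"
    unfolding sr real_sqrt_mult using pos by simp
  moreover have "real m * (a * b) * ((sqrt (stable_rank A * stable_rank B) + 1) * t / real m)
      = (F * G + a * b) * t"
    using pos assms(3) by (simp add: sqrt_sr field_simps)
  ultimately have \<tau>: "real m * (a * b) * \<tau> = sqrt (2 * real m * v * t) + (F * G + a * b) * t"
    by (simp add: \<tau>_def distrib_left)
  \<comment> \<open>Scaling by \<open>real m * (a * b)\<close> turns the normalised error of the
    estimator into the norm of the centred sum.\<close>
  have "\<tau> < spectral_norm (product_estimator m X \<omega> - A ** transpose B) / (a * b)
      \<longleftrightarrow> real m * (a * b) * \<tau> < spectral_norm (\<Sum>j=1..m. X j \<omega> - A ** transpose B)" for \<omega>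
  proof -
    let ?D = "product_estimator m X \<omega> - A ** transpose B"
    have "(\<Sum>j=1..m. X j \<omega> - A ** transpose B) = real m *\<^sub>R ?D"
      using assms(3)
      by (simp add: product_estimator_def sum_subtractf scaleR_diff_right sum_constant_scaleR del: sum_constant)
    moreover have "(*v) (real m *\<^sub>R ?D) = (\<lambda>x. real m *\<^sub>R (?D *v x))"
      by (simp add: fun_eq_iff flip: scaleR_matrix_vector_assoc)
    ultimately have "spectral_norm (\<Sum>j=1..m. X j \<omega> - A ** transpose B) = real m * spectral_norm ?D"
      by (simp only: onorm_scaleR[OF matrix_vector_mul_bounded_linear] abs_of_nat)
    then show ?thesis
      using pos assms(3) by (simp add: pos_less_divide_eq mult.assoc mult.commute[of \<tau>])
  qed
  then have "measure M {\<omega> \<in> space M.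
        \<tau> < spectral_norm (product_estimator m X \<omega> - A ** transpose B) / (a * b)}
      \<le> 4 * F\<^sup>2 * G\<^sup>2 / v * (t / (exp t - t - 1))"
    using sum_centred_sample_tail[OF assms]
    unfolding \<tau> by (simp only: a_def b_def F_def G_def v_def)
  \<comment> \<open>The product of the stable ranks is their maximum times their minimum, and the
    maximum cancels against \<open>v\<close>.\<close>
  also have "4 * F\<^sup>2 * G\<^sup>2 / v = 2 * min (stable_rank A) (stable_rank B)"
  proof -
    have "4 * F\<^sup>2 * G\<^sup>2 = 4 * (a * b)\<^sup>2 * (stable_rank A * stable_rank B)"
      using pos by (simp add: sr power_mult_distrib power_divide)
    moreover have "stable_rank A * stable_rank B
        = max (stable_rank A) (stable_rank B) * min (stable_rank A) (stable_rank B)"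
      by (simp add: max_def min_def)
    moreover have "0 < max (stable_rank A) (stable_rank B)"
      using pos by (simp add: sr less_max_iff_disj)
    ultimately show ?thesis
      using pos by (simp add: v)
  qed
  \<comment> \<open>The argument yields the constant 2, which is relaxed to the claimed 4.\<close>
  also have "2 * min (stable_rank A) (stable_rank B) * (t / (exp t - t - 1))
      \<le> 4 * min (stable_rank A) (stable_rank B) * (t / (exp t - t - 1))"
  proof (rule mult_right_mono)
    show "2 * min (stable_rank A) (stable_rank B) \<le> 4 * min (stable_rank A) (stable_rank B)"
      by (simp add: sr)
    have "0 \<le> exp t - t - 1" using exp_ge_add_one_self[of t] by linarith
    then show "0 \<le> t / (exp t - t - 1)" using assms(7) by simp
  qed
  finally show ?thesis by (simp only: \<tau>_def a_def b_def)
qed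

end
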